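(* Every countable left-ordered group $G$ embeds into a finitely generated left-ordered simple group $H$. Moreover, the order on $H$ continues the order on $G$ (that is, identifying $G$ with its image in $H$, the restriction to $G$ of the left-order of $H$ is the given left-order of $G$).
   Context: A left-ordered group is a group together with a linear (total) order that is invariant under multiplication from the left. A group is simple if it has no proper non-trivial normal subgroups. *)

theory Defs
  imports "HOL-Algebra.Generated_Groups" "HOL-Library.Countable_Set"
begin

definition left_ordered_group :: "('a, 'b) monoid_scheme \<Rightarrow> 'a rel \<Rightarrow> bool" where
  "left_ordered_group G r \<longleftrightarrow>
     group G \<and> linear_order_on (carrier G) r \<and>
     (\<forall>a\<in>carrier G. \<forall>x\<in>carrier G. \<forall>y\<in>carrier G.
        (x, y) \<in> r \<longrightarrow> (a \<otimes>\<^bsub>G\<^esub> x, a \<otimes>\<^bsub>G\<^esub> y) \<in> r)"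

(* The locale simple_group of HOL-Algebra requires order G > 1, where order G = card (carrier G)
   is 0 for infinite G; it therefore excludes all infinite groups and cannot be used here. *)
definition is_simple :: "('a, 'b) monoid_scheme \<Rightarrow> bool" where
  "is_simple G \<longleftrightarrow>
     group G \<and> (\<forall>N. N \<lhd> G \<longrightarrow> N = carrier G \<or> N = {\<one>\<^bsub>G\<^esub>})"

definition finitely_generated :: "('a, 'b) monoid_scheme \<Rightarrow> bool" where
  "finitely_generated G \<longleftrightarrow>
     (\<exists>S. finite S \<and> S \<subseteq> carrier G \<and> generate G S = carrier G)"

end

theory Submission
  imports Defs "HOL-Library.Fun_Lexorder" "HOL-Computational_Algebra.Primes"
begin

text \<open>
  The group \<open>H\<close> consists of order automorphisms of the rationals. Left orders are then for free: compare
  two automorphisms at the first point, in some enumeration, where they differ. If the enumeration starts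
  with a point \<open>x0\<close> whose orbit under \<open>G\<close> is a copy of the ordered group \<open>G\<close>, then the order extends that
  of \<open>G\<close>. Such an action of \<open>G\<close> exists on the interval \<open>J = (0, 1/2)\<close>, since \<open>J\<close> is isomorphic to
  \<open>G \<times> \<rat>\<close> with the lexicographic order (\<open>left_ordered_action\<close>).

  The elements of bounded support form a normal subgroup, and finitely many of them do not move points far
  away; thus only the identity of \<open>H\<close> may have bounded support. Therefore local moves are repeated all
  over the line, in an aperiodic but recurrent way. Cut the line into the cells \<open>[m, m + 1)\<close>, and mark
  the cells whose number belongs to the Toeplitz set \<open>W\<close> that consists of 0 and all integers of even
  2-adic valuation. For an automorphism \<open>p\<close> of \<open>J\<close>, \<open>spread C p\<close> performs \<open>p\<close> in all cells with number
  in \<open>C\<close>. The generators of \<open>H\<close> are \<open>spread UNIV p\<close> and \<open>spread W p\<close> for three automorphisms \<open>p\<close>,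
  and the rotation \<open>x \<mapsto> x + 1/8\<close>.

  Three ideas make this work.

  \<^item> \<^emph>\<open>Commutators intersect.\<close> The commutator of \<open>spread C a\<close> and \<open>spread D b\<close> is the commutator of \<open>a\<close>
    and \<open>b\<close>, spread over \<open>C \<inter> D\<close>. Since the shift by 1 belongs to \<open>H\<close>, commutators produce spreads over all
    sets of cells that are defined by finite patterns of marks.

  \<^item> \<^emph>\<open>Encoding.\<close> Infinitely many automorphisms of \<open>J\<close>, among them those of \<open>G\<close>, can be packed into a
    single one, from which two auxiliary automorphisms extract compressed copies by commutators. The
    packed automorphism contains copies of itself, so that it is extracted as well
    (\<open>self_encoding\<close>). A finitely generated group of circle maps, generated by the rotation and a
    bump, undoes the compression (\<open>arc_into_interval\<close>). All encoded automorphisms are thus commutators up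
    to conjugation, which replaces perfectness elsewhere in the argument.

  \<^item> \<^emph>\<open>Displacement.\<close> A nontrivial element of a normal subgroup \<open>N\<close> moves some interval off itself. Since
    elements of \<open>H\<close> are determined by finitely many marks nearby (\<open>H_local\<close>), it does so at all occurrences
    of some pattern of marks simultaneously, and \<open>N\<close> contains the commutators of all elements
    of \<open>H\<close> supported there (\<open>nontrivial_normalH_spreads\<close>). Every pattern recurs along
    a residue class, so finitely many translates of its occurrences cover all cells, and \<open>N\<close> contains all generators (\<open>H_simple\<close>).
\<close>

section \<open>Order automorphisms of the rationals\<close>

text \<open>The notation inv denotes inverses in an abstract group, hence the separate name.\<close>

abbreviation inv_fun :: "('a \<Rightarrow> 'b) \<Rightarrow> 'b \<Rightarrow> 'a" where
  "inv_fun f \<equiv> inv_into UNIV f"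

definition aut :: "(rat \<Rightarrow> rat) \<Rightarrow> bool" where
  "aut f \<longleftrightarrow> strict_mono f \<and> surj f"

lemma aut_bij: "aut f \<Longrightarrow> bij f"
  by (simp add: aut_def bij_def strict_mono_imp_inj_on)

lemma aut_less: "aut f \<Longrightarrow> f x < f y \<longleftrightarrow> x < y"
  by (simp add: aut_def strict_mono_less)

lemma aut_eq: "aut f \<Longrightarrow> f x = f y \<longleftrightarrow> x = y"
  by (simp add: aut_def strict_mono_eq)

lemma aut_inv1 [simp]: "aut f \<Longrightarrow> inv_fun f (f x) = x"
  by (simp add: aut_bij bij_is_inj)

lemma aut_inv2 [simp]: "aut f \<Longrightarrow> f (inv_fun f x) = x"
  by (simp add: aut_def surj_f_inv_f)

lemma aut_id [simp]: "aut id" "aut (\<lambda>x. x)"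
  by (simp_all add: aut_def strict_mono_def)

lemma aut_comp [simp]: "aut f \<Longrightarrow> aut g \<Longrightarrow> aut (f \<circ> g)"
  unfolding aut_def by (intro conjI comp_surj) (auto simp: strict_mono_def)

lemma aut_inv [simp]: "aut f \<Longrightarrow> aut (inv_fun f)"
  unfolding aut_def
  by (metis aut_bij aut_def bij_imp_bij_inv bij_is_surj strict_mono_inv_on_range strict_mono_on_def
      strict_mono_def surj_f_inv_f strict_mono_less)

lemma aut_inv_eq_iff: "aut f \<Longrightarrow> inv_fun f x = y \<longleftrightarrow> x = f y"
  by auto

lemma inv_inv_aut [simp]: "aut f \<Longrightarrow> inv_fun (inv_fun f) = f"
  by (simp add: aut_bij inv_inv_eq)

lemma inv_comp_aut: "aut f \<Longrightarrow> aut g \<Longrightarrow> inv_fun (f \<circ> g) = inv_fun g \<circ> inv_fun f"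
  by (simp add: aut_bij o_inv_distrib)

lemma inv_eqI_aut: "aut f \<Longrightarrow> (\<And>x. f (g x) = x) \<Longrightarrow> inv_fun f = g"
  by (rule ext) (simp add: aut_inv_eq_iff)

lemma aut_inverseI:
  assumes "\<And>x y. x < y \<Longrightarrow> f x < f y" "\<And>x. f (g x) = x"
  shows "aut f"
  unfolding aut_def strict_mono_def using assms by (metis surj_def)

lemma aut_shift: "aut (\<lambda>x. x + a)"
  by (rule aut_inverseI[where g="\<lambda>x. x - a"]) auto

lemma aut_affine: "0 < a \<Longrightarrow> aut (\<lambda>x. a * x + b)"
  by (rule aut_inverseI[where g="\<lambda>x. (x - b) / a"]) (auto simp: field_simps)

text \<open>A bijection that fixes everything outside \<open>D\<close> cannot send a point of \<open>D\<close> to a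
  point outside: that point is already its own image.\<close>

lemma aut_image_support:
  assumes "aut f" "\<And>x. x \<notin> D \<Longrightarrow> f x = x" "x \<in> D"
  shows "f x \<in> D"
  using assms by (metis aut_eq)

text \<open>Automorphisms with pairwise disjoint supports, infinitely many perhaps, can be
  performed all at once. To see that the result is increasing, take \<open>x < y\<close> that are not in the
  same support, and move \<open>x\<close> first, by a map that fixes \<open>y\<close>, and then \<open>y\<close>, by a map that fixes the
  new position of \<open>x\<close>.\<close>

lemma aut_glue:
  assumes F: "\<And>a. aut (F a)" and supp: "\<And>a x. x \<notin> D a \<Longrightarrow> F a x = x"
    and disj: "\<And>a b x. x \<in> D a \<Longrightarrow> x \<in> D b \<Longrightarrow> a = b"
    and on: "\<And>a x. x \<in> D a \<Longrightarrow> g x = F a x"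
    and off: "\<And>x. (\<And>a. x \<notin> D a) \<Longrightarrow> g x = x"
  shows "aut g"
proof -
  have one: "\<exists>f. aut f \<and> f x = g x \<and> (\<forall>y. f y = y \<or> (\<exists>a. x \<in> D a \<and> y \<in> D a \<and> f = F a))" for x
    using F on off supp by (cases "\<exists>a. x \<in> D a") (metis, metis aut_id(1) id_apply)
  have "g x < g y" if "x < y" for x y
  proof (cases "\<exists>a. x \<in> D a \<and> y \<in> D a")
    case True
    then show ?thesis using on F aut_less that by metis
  next
    case False
    obtain f where f: "aut f" "f x = g x" "f y = y"
      using one[of x] False by metis
    obtain h where h: "aut h" "h y = g y"
      "\<And>z. h z = z \<or> (\<exists>a. y \<in> D a \<and> z \<in> D a \<and> h = F a)"
      using one[of y] by metis
    have "h (g x) = g x"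
    proof (rule ccontr)
      assume "h (g x) \<noteq> g x"
      then obtain a where a: "y \<in> D a" "g x \<in> D a" using h(3) by metis
      show False
      proof (cases "\<exists>b. x \<in> D b")
        case True
        then obtain b where b: "x \<in> D b" by blast
        then have "g x \<in> D b" using aut_image_support[OF F supp] on by metis
        then show False using a b False disj by blast
      next
        case False2: False
        then show False using off a False by metis
      qed
    qed
    moreover have "g x < y" using aut_less[OF f(1), of x y] f that by simp
    ultimately show ?thesis using aut_less[OF h(1), of "g x" y] h(2) by simp
  qed
  moreover have "\<exists>x. g x = y" for y
  proof (cases "\<exists>a. y \<in> D a")
    case True
    then obtain a where a: "y \<in> D a" by blast
    have "inv_fun (F a) y \<in> D a" by (metis F a aut_inv2 supp)
    then show ?thesis using on F aut_inv2 by metis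
  qed (use off in blast)
  ultimately show ?thesis unfolding aut_def strict_mono_def by (metis surj_def)
qed

section \<open>Automorphisms of one half cell and their copies\<close>

text \<open>Every cell \<open>[m, m + 1)\<close> contains the translate of this interval by \<open>m\<close>. Its closure is
  shorter than the cell, so that it is a proper arc of the circle obtained by identifying all cells.
  All local moves take place inside these half cells.\<close>

definition J :: "rat set" where
  "J = {x. 0 < x \<and> x < 1/2}"

definition autJ :: "(rat \<Rightarrow> rat) \<Rightarrow> bool" where
  "autJ p \<longleftrightarrow> aut p \<and> (\<forall>x. x \<notin> J \<longrightarrow> p x = x)"

lemma autJ_aut: "autJ p \<Longrightarrow> aut p"
  by (simp add: autJ_def)

lemma autJ_J: "autJ p \<Longrightarrow> p x \<in> J \<longleftrightarrow> x \<in> J"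
  unfolding autJ_def by (metis aut_image_support)

lemma autJ_id [simp]: "autJ id"
  by (simp add: autJ_def)

lemma autJ_comp [simp]: "autJ p \<Longrightarrow> autJ q \<Longrightarrow> autJ (p \<circ> q)"
  by (simp add: autJ_def)

lemma autJ_inv [simp]: "autJ p \<Longrightarrow> autJ (inv_fun p)"
  unfolding autJ_def by (metis aut_inv aut_inv_eq_iff)

lemma autJ_conj:
  assumes p: "autJ p" and c: "aut c" "\<And>x. x \<in> J \<Longrightarrow> c x \<in> J"
  shows "autJ (c \<circ> p \<circ> inv_fun c)"
proof -
  have "c (p (inv_fun c x)) = x" if "x \<notin> J" for x
  proof -
    have "inv_fun c x \<notin> J" using c that by (metis aut_inv2)
    then show ?thesis using p c by (simp add: autJ_def)
  qed
  then show ?thesis using p c by (simp add: autJ_def)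
qed

definition spread :: "int set \<Rightarrow> (rat \<Rightarrow> rat) \<Rightarrow> rat \<Rightarrow> rat" where
  "spread C p x = (if \<lfloor>x\<rfloor> \<in> C then of_int \<lfloor>x\<rfloor> + p (frac x) else x)"

lemma autJ_unit: "autJ p \<Longrightarrow> 0 \<le> x \<Longrightarrow> x < 1 \<Longrightarrow> 0 \<le> p x \<and> p x < 1"
  using autJ_J[of p x] by (cases "x \<in> J") (auto simp: autJ_def J_def)

lemma floor_spread: "autJ p \<Longrightarrow> \<lfloor>spread C p x\<rfloor> = \<lfloor>x\<rfloor>"
  using autJ_unit[of p "frac x"] by (auto simp: spread_def frac_lt_1 intro: floor_unique)

lemma frac_spread: "autJ p \<Longrightarrow> frac (spread C p x) = (if \<lfloor>x\<rfloor> \<in> C then p (frac x) else frac x)"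
  using floor_spread[of p C x] by (auto simp: frac_def spread_def)

lemma frac_eqI: "\<lfloor>x\<rfloor> = \<lfloor>y\<rfloor> \<Longrightarrow> frac x = frac y \<Longrightarrow> (x::rat) = y"
  by (simp add: frac_def)

lemma spread_id [simp]: "spread C id = id"
  by (rule ext) (simp add: spread_def frac_def)

lemma spread_comp: "autJ p \<Longrightarrow> autJ q \<Longrightarrow> spread C p \<circ> spread C q = spread C (p \<circ> q)"
  by (rule ext, rule frac_eqI) (simp_all add: floor_spread frac_spread)

lemma aut_spread:
  assumes "autJ p"
  shows "aut (spread C p)"
proof (rule aut_glue)
  let ?D = "\<lambda>m. {x. m \<in> C \<and> x - of_int m \<in> J}" and ?F = "\<lambda>m::int. (\<lambda>x. x + of_int m) \<circ> p \<circ> (\<lambda>x. x + (- of_int m))"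
  let ?F = "\<lambda>m. if m \<in> C then ?F m else id"
  have fl: "x - of_int m \<in> J \<Longrightarrow> \<lfloor>x\<rfloor> = m" for x :: rat and m
    by (simp add: J_def floor_eq_iff)
  show "aut (?F m)" for m
    using assms by (simp add: autJ_aut aut_shift del: add_uminus_conv_diff)
  show "?F m x = x" if "x \<notin> ?D m" for m x
    using that assms by (auto simp: autJ_def)
  show "m = n" if "x \<in> ?D m" "x \<in> ?D n" for m n x
    using that fl by auto
  show "spread C p x = ?F m x" if "x \<in> ?D m" for m x
    using that fl by (auto simp: spread_def frac_def)
  show "spread C p x = x" if "\<And>m. x \<notin> ?D m" for x
    using that[of "\<lfloor>x\<rfloor>"] assms by (auto simp: spread_def frac_def autJ_def)
qed

lemma inv_spread:
  assumes "autJ p"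
  shows "inv_fun (spread C p) = spread C (inv_fun p)"
proof (rule inv_eqI_aut[OF aut_spread[OF assms]])
  show "spread C p (spread C (inv_fun p) x) = x" for x
    by (rule frac_eqI) (use assms in \<open>simp_all add: floor_spread frac_spread autJ_aut\<close>)
qed

text \<open>Outside the cells in \<open>C \<inter> D\<close> one of the two factors is trivial, so that commutators
  turn two sets of cells into their intersection.\<close>

lemma spread_commutator:
  assumes "autJ p" "autJ q"
  shows "spread C p \<circ> spread D q \<circ> inv_fun (spread C p) \<circ> inv_fun (spread D q)
       = spread (C \<inter> D) (p \<circ> q \<circ> inv_fun p \<circ> inv_fun q)"
  by (rule ext, rule frac_eqI) (use assms in \<open>simp_all add: floor_spread frac_spread inv_spread autJ_aut\<close>)

lemma spread_Compl:
  assumes "autJ p"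
  shows "spread (- C) p = spread UNIV p \<circ> inv_fun (spread C p)"
  by (rule ext, rule frac_eqI) (use assms in \<open>simp_all add: floor_spread frac_spread inv_spread autJ_aut\<close>)

lemma spread_Un:
  assumes "autJ p"
  shows "spread (C \<union> D) p = spread C p \<circ> spread (D \<inter> - C) p"
  by (rule ext, rule frac_eqI) (use assms in \<open>simp_all add: floor_spread frac_spread\<close>)

definition shift :: "rat \<Rightarrow> rat" where
  "shift x = x + 1"

lemma shift_aut: "aut shift"
  unfolding shift_def by (rule aut_shift)

lemma inv_shift: "inv_fun shift x = x - 1"
  by (simp add: aut_inv_eq_iff shift_aut shift_def)

lemma shift_spread: "shift \<circ> spread C p \<circ> inv_fun shift = spread ((\<lambda>m. m + 1) ` C) p"
proof
  fix x :: rat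
  have "\<lfloor>x\<rfloor> \<in> (\<lambda>m. m + 1) ` C \<longleftrightarrow> \<lfloor>x\<rfloor> - 1 \<in> C" by (auto intro: image_eqI[where x="\<lfloor>x\<rfloor> - 1"])
  then show "(shift \<circ> spread C p \<circ> inv_fun shift) x = spread ((\<lambda>m. m + 1) ` C) p x"
    by (auto simp: shift_def inv_shift spread_def frac_def)
qed

definition periodic :: "(rat \<Rightarrow> rat) \<Rightarrow> bool" where
  "periodic f \<longleftrightarrow> (\<forall>x. f (x + 1) = f x + 1)"

lemma periodic_int:
  assumes "periodic f"
  shows "f (x + of_int m) = f x + of_int m"
proof (induction m rule: int_induct[where k=0])
  case (step1 i)
  have "f (x + of_int i + 1) = f (x + of_int i) + 1" using assms by (simp only: periodic_def)
  then show ?case using step1 by (simp add: algebra_simps)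
next
  case (step2 i)
  have "f (x + of_int (i - 1) + 1) = f (x + of_int (i - 1)) + 1" using assms by (simp only: periodic_def)
  then show ?case using step2 by (simp add: algebra_simps)
qed simp

lemma periodic_spread_UNIV: "periodic (spread UNIV p)"
  by (simp add: periodic_def spread_def frac_def)

lemma J_cell:
  assumes "x - of_int m \<in> J"
  shows "\<lfloor>x\<rfloor> = m \<and> frac x \<in> J"
proof -
  have "\<lfloor>x\<rfloor> = m" using assms by (simp add: J_def floor_eq_iff)
  then show ?thesis using assms by (simp add: frac_def)
qed

text \<open>A periodic map \<open>c\<close> that sends the half cell into itself does the same in every cell,
  hence conjugation by \<open>c\<close> compresses all the copies of \<open>p\<close> at once.\<close>

lemma conj_spread:
  assumes p: "autJ p" and c: "aut c" "periodic c" "\<And>x. x \<in> J \<Longrightarrow> c x \<in> J"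
  shows "c \<circ> spread C p \<circ> inv_fun c = spread C (c \<circ> p \<circ> inv_fun c)"
proof -
  have pc: "autJ (c \<circ> p \<circ> inv_fun c)" by (rule autJ_conj[OF p c(1,3)])
  have "c (spread C p x) = spread C (c \<circ> p \<circ> inv_fun c) (c x)" for x
  proof (cases "frac x \<in> J")
    case True
    have x: "x = frac x + of_int \<lfloor>x\<rfloor>" by (simp add: frac_def)
    have cx: "c x = c (frac x) + of_int \<lfloor>x\<rfloor>" using periodic_int[OF c(2)] x by metis
    have f: "\<lfloor>c x\<rfloor> = \<lfloor>x\<rfloor>" using J_cell[of "c x" "\<lfloor>x\<rfloor>"] c(3)[OF True] cx by simp
    then have "frac (c x) = c (frac x)" using cx by (simp add: frac_def)
    moreover have "c (of_int \<lfloor>x\<rfloor> + p (frac x)) = c (p (frac x)) + of_int \<lfloor>x\<rfloor>"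
      using periodic_int[OF c(2)] by (metis add.commute)
    ultimately show ?thesis using f c(1) by (simp add: spread_def)
  next
    case False
    then have l: "spread C p x = x" using p by (simp add: spread_def autJ_def frac_def)
    have "(c \<circ> p \<circ> inv_fun c) (frac (c x)) = frac (c x)"
    proof -
      have "inv_fun c (frac (c x)) = x + of_int (- \<lfloor>c x\<rfloor>)"
        using periodic_int[OF c(2), of x "- \<lfloor>c x\<rfloor>"] c(1) by (simp add: aut_inv_eq_iff frac_def)
      moreover have "x + of_int (- \<lfloor>c x\<rfloor>) \<notin> J" using J_cell[of x "\<lfloor>c x\<rfloor>"] False by auto
      ultimately have "p (inv_fun c (frac (c x))) = inv_fun c (frac (c x))" using p by (simp add: autJ_def)
      then show ?thesis using c(1) by simp
    qed
    then show ?thesis using l by (simp add: spread_def frac_def)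
  qed
  from this[of "inv_fun c y" for y] show ?thesis using c(1) by (intro ext) simp
qed

text \<open>This is how periodic maps enter the local picture once their support has been squeezed
  into the half cell.\<close>

lemma periodic_eq_spread:
  assumes f: "aut f" "periodic f" "\<And>x. 0 \<le> x \<Longrightarrow> x < 1 \<Longrightarrow> x \<notin> J \<Longrightarrow> f x = x"
  obtains r where "autJ r" "f = spread UNIV r"
proof -
  define r where "r x = (if x \<in> J then f x else x)" for x
  have fJ: "f x \<in> J" if "x \<in> J" for x
  proof -
    have "f 0 = 0" "f (1/2) = 1/2" using f(3)[of 0] f(3)[of "1/2"] by (auto simp: J_def)
    then show ?thesis using aut_less[OF f(1), of 0 x] aut_less[OF f(1), of x "1/2"] that by (simp add: J_def)
  qed
  have eq: "f x = of_int \<lfloor>x\<rfloor> + f (frac x)" for x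
    using periodic_int[OF f(2), of "frac x" "\<lfloor>x\<rfloor>"] by (simp add: frac_def)
  have "f x = spread UNIV r x" for x
    using eq[of x] f(3)[of "frac x"] by (auto simp: spread_def r_def frac_lt_1)
  moreover have "aut r"
  proof (rule aut_inverseI)
    show "r x < r y" if "x < y" for x y
      using aut_less[OF f(1), of x y] fJ[of x] fJ[of y] that by (auto simp: r_def J_def)
    show "r (if x \<in> J then inv_fun f x else x) = x" for x
    proof (cases "x \<in> J")
      case True
      have "f 0 = 0" "f (1/2) = 1/2" using f(3)[of 0] f(3)[of "1/2"] by (auto simp: J_def)
      then have "inv_fun f x \<in> J"
        using aut_less[OF f(1), of 0 "inv_fun f x"] aut_less[OF f(1), of "inv_fun f x" "1/2"] True f(1) by (simp add: J_def)
      then show ?thesis using f(1) True by (simp add: r_def)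
    qed (simp add: r_def)
  qed
  ultimately show ?thesis using that[of r] by (auto simp: autJ_def r_def)
qed

section \<open>Groups of automorphisms\<close>

definition AutQ :: "(rat \<Rightarrow> rat) monoid" where
  "AutQ = \<lparr>carrier = {f. aut f}, monoid.mult = (\<circ>), one = id\<rparr>"

lemma AutQ_simps [simp]:
  "carrier AutQ = {f. aut f}" "monoid.mult AutQ = (\<circ>)" "monoid.one AutQ = id"
  by (simp_all add: AutQ_def)

lemma AutQ_group: "group AutQ"
proof (rule groupI)
  fix f assume "f \<in> carrier AutQ"
  then have "inv_fun f \<in> carrier AutQ" "inv_fun f \<circ> f = id" by (auto intro: ext)
  then show "\<exists>g\<in>carrier AutQ. g \<otimes>\<^bsub>AutQ\<^esub> f = \<one>\<^bsub>AutQ\<^esub>" by auto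
qed (auto simp: comp_assoc)

lemma AutQ_inv [simp]: "aut f \<Longrightarrow> m_inv AutQ f = inv_fun f"
  by (rule group.inv_equality[OF AutQ_group]) (auto intro!: ext)

abbreviation gen :: "(rat \<Rightarrow> rat) set \<Rightarrow> (rat \<Rightarrow> rat) set" where
  "gen \<equiv> generate AutQ"

text \<open>Subgroups of \<open>AutQ\<close>, unfolded so that proofs deal with functions instead of group records.\<close>

definition subgrp :: "(rat \<Rightarrow> rat) set \<Rightarrow> bool" where
  "subgrp K \<longleftrightarrow> (\<forall>f\<in>K. aut f) \<and> id \<in> K \<and> (\<forall>f\<in>K. \<forall>g\<in>K. f \<circ> g \<in> K) \<and> (\<forall>f\<in>K. inv_fun f \<in> K)"

lemma subgrp_iff_subgroup: "subgrp K \<longleftrightarrow> subgroup K AutQ"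
proof -
  have "(\<forall>f\<in>K. inv_fun f \<in> K) \<longleftrightarrow> (\<forall>f\<in>K. m_inv AutQ f \<in> K)" if "\<forall>f\<in>K. aut f"
    using that by simp
  then show ?thesis unfolding subgrp_def subgroup_def by (auto simp: subset_iff)
qed

lemma subgrpD:
  assumes "subgrp K"
  shows "\<And>f. f \<in> K \<Longrightarrow> aut f" "id \<in> K" "\<And>f g. f \<in> K \<Longrightarrow> g \<in> K \<Longrightarrow> f \<circ> g \<in> K" "\<And>f. f \<in> K \<Longrightarrow> inv_fun f \<in> K"
  using assms by (auto simp: subgrp_def)

lemma subgrp_gen: "\<forall>f\<in>S. aut f \<Longrightarrow> subgrp (gen S)"
  unfolding subgrp_iff_subgroup by (rule group.generate_is_subgroup[OF AutQ_group]) auto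

lemma gen_base: "f \<in> S \<Longrightarrow> f \<in> gen S"
  by (rule generate.incl)

lemma gen_le: "subgrp K \<Longrightarrow> S \<subseteq> K \<Longrightarrow> gen S \<subseteq> K"
  unfolding subgrp_iff_subgroup by (rule group.generate_subgroup_incl[OF AutQ_group])

lemma subgrp_conj: "subgrp K \<Longrightarrow> f \<in> K \<Longrightarrow> g \<in> K \<Longrightarrow> f \<circ> g \<circ> inv_fun f \<in> K"
  by (simp add: subgrpD)

lemma subgrp_funpow: "subgrp K \<Longrightarrow> f \<in> K \<Longrightarrow> f ^^ n \<in> K"
  by (induction n) (auto simp: subgrpD)

section \<open>A group of circle maps\<close>

text \<open>A standard generator of the dyadic piecewise linear group of Thompson, on \<open>[0, 1/2]\<close>. It
  expands by two near 0, and it agrees with the rotation by 1/8 on \<open>[1/8, 1/4]\<close>.\<close>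

definition bump :: "rat \<Rightarrow> rat" where
  "bump x = (if x < 0 \<or> 1/2 < x then x
     else if x \<le> 1/8 then 2 * x else if x \<le> 1/4 then x + 1/8 else x / 2 + 1/4)"

lemma autJ_bump: "autJ bump"
proof -
  have "aut bump"
    by (rule aut_inverseI[where g="\<lambda>x. if x < 0 \<or> 1/2 < x then x else
        if x \<le> 1/4 then x / 2 else if x \<le> 3/8 then x - 1/8 else 2 * x - 1/2"])
      (auto simp: bump_def field_simps)
  then show ?thesis by (auto simp: autJ_def J_def bump_def)
qed

lemma bump_gt: "x \<in> J \<Longrightarrow> x < bump x"
  by (auto simp: J_def bump_def)

definition rot :: "rat \<Rightarrow> rat" where
  "rot x = x + 1/8"

text \<open>A finitely generated group of maps that commute with the shift by 1, that is, a group of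
  lifts of circle maps. It contains the shift itself, being the eighth power of the rotation.\<close>

definition circle_group :: "(rat \<Rightarrow> rat) set" where
  "circle_group = gen {rot, spread UNIV bump}"

lemma rot_aut: "aut rot"
  unfolding rot_def by (rule aut_shift)

lemma circle_group_subgrp: "subgrp circle_group"
  unfolding circle_group_def by (rule subgrp_gen) (simp add: rot_aut aut_spread autJ_bump)

lemma rot_circ: "rot \<in> circle_group" and bump_circ: "spread UNIV bump \<in> circle_group"
  by (simp_all add: circle_group_def gen_base)

lemma circle_group_aut: "q \<in> circle_group \<Longrightarrow> aut q"
  using circle_group_subgrp by (rule subgrpD)

lemma subgrp_periodic: "subgrp {f. aut f \<and> periodic f}"
  unfolding subgrp_def
proof (intro conjI ballI)
  fix f assume f: "f \<in> {f. aut f \<and> periodic f}"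
  then have "inv_fun f (x + 1) = inv_fun f x + 1" for x
    by (auto simp: aut_inv_eq_iff periodic_def)
  then show "inv_fun f \<in> {f. aut f \<and> periodic f}" using f by (simp add: periodic_def)
qed (auto simp: periodic_def)

lemma circle_group_periodic: "q \<in> circle_group \<Longrightarrow> periodic q"
proof -
  have "periodic rot" by (simp add: periodic_def rot_def)
  then have "circle_group \<subseteq> {f. aut f \<and> periodic f}"
    unfolding circle_group_def by (intro gen_le subgrp_periodic)
      (auto simp: rot_aut aut_spread autJ_bump periodic_spread_UNIV)
  then show "q \<in> circle_group \<Longrightarrow> periodic q" by blast
qed

lemma rot_pow: "(rot ^^ n) x = x + of_nat n / 8"
  by (induction n) (auto simp: rot_def field_simps)

lemma rotation_circ: "\<exists>q\<in>circle_group. \<forall>x. q x = x + of_int m / 8"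
proof (cases "0 \<le> m")
  case True
  have "(rot ^^ nat m) x = x + of_int m / 8" for x using rot_pow[of "nat m" x] True by simp
  then show ?thesis using subgrp_funpow[OF circle_group_subgrp rot_circ] by blast
next
  case False
  have "inv_fun (rot ^^ nat (-m)) x = x + of_int m / 8" for x
    using rot_pow[of "nat (-m)" "x + of_int m / 8"] False subgrp_funpow[OF circle_group_subgrp rot_circ, THEN circle_group_aut]
    by (simp add: aut_inv_eq_iff)
  then show ?thesis using subgrp_funpow[OF circle_group_subgrp rot_circ, of "nat (-m)"] subgrpD(4)[OF circle_group_subgrp] by blast
qed

lemma shift_circ: "shift \<in> circle_group"
proof -
  obtain q where "q \<in> circle_group" "\<forall>x. q x = x + of_int 8 / 8" using rotation_circ by blast
  then show ?thesis by (metis ext shift_def div_self of_int_numeral zero_neq_numeral)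
qed

lemma bump_cell: "0 \<le> x \<Longrightarrow> x < 1 \<Longrightarrow> spread UNIV bump x = bump x"
  using floor_unique[of 0 x] by (simp add: spread_def frac_def)

text \<open>Induction on the exponent of the denominator: a rotation brings the point into
  \<open>[0, 1/8]\<close>, where the bump doubles it.\<close>

lemma dyadic_to_zero: "\<exists>q\<in>circle_group. q (of_int a / 2 ^ n) = 0"
proof (induction n arbitrary: a)
  case 0
  obtain q where "q \<in> circle_group" "\<forall>x. q x = x + of_int (- 8 * a) / 8" using rotation_circ by blast
  then show ?case by (intro bexI[of _ q]) auto
next
  case (Suc n)
  define m where "m = \<lfloor>8 * of_int a / 2 ^ Suc n :: rat\<rfloor>"
  let ?x = "of_int a / 2 ^ Suc n :: rat"
  obtain q where q: "q \<in> circle_group" "\<forall>x. q x = x + of_int (- m) / 8" using rotation_circ by blast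
  have m: "of_int m \<le> 8 * ?x" "8 * ?x < of_int m + 1"
    unfolding m_def by linarith+
  have y: "0 \<le> q ?x" "q ?x \<le> 1/8" using m spec[OF q(2), of ?x] by simp_all
  have b: "spread UNIV bump (q ?x) = 2 * q ?x" using y by (simp add: bump_cell) (simp add: bump_def)
  obtain q' where q': "q' \<in> circle_group" "\<forall>x. q' x = x + of_int m / 4"
    using rotation_circ[of "2 * m"] by auto
  have "q' (spread UNIV bump (q ?x)) = of_int a / 2 ^ n"
  proof -
    have "q' (spread UNIV bump (q ?x)) = 2 * q ?x + of_int m / 4" using b q' by simp
    also have "\<dots> = 2 * ?x" using spec[OF q(2), of ?x] by simp
    finally show ?thesis by simp
  qed
  moreover obtain q0 where "q0 \<in> circle_group" "q0 (of_int a / 2 ^ n) = 0" using Suc by blast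
  ultimately have "(q0 \<circ> q' \<circ> spread UNIV bump \<circ> q) ?x = 0" by simp
  moreover have "q0 \<circ> q' \<circ> spread UNIV bump \<circ> q \<in> circle_group"
    using \<open>q0 \<in> circle_group\<close> by (intro subgrpD(3)[OF circle_group_subgrp] q q' bump_circ)
  ultimately show ?case by (rule bexI)
qed

lemma dyadic_between:
  assumes "(u::rat) < v"
  obtains a :: int and n where "u < of_int a / 2 ^ n" "of_int a / 2 ^ n < v"
proof -
  obtain n where "1 / (v - u) < of_nat n" using reals_Archimedean2 by blast
  moreover have "(of_nat n :: rat) < 2 ^ n"
    using of_nat_less_iff[of n "2 ^ n", where 'a=rat] less_exp[of n] by simp
  ultimately have n: "1 / (v - u) < 2 ^ n" by linarith
  define a where "a = \<lfloor>u * 2 ^ n\<rfloor> + 1"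
  have "of_int a > u * 2 ^ n" "of_int a \<le> u * 2 ^ n + 1" unfolding a_def by linarith+
  moreover have "u * 2 ^ n + 1 < v * 2 ^ n" using n assms by (simp add: field_simps)
  ultimately show ?thesis by (intro that[of a n]) (simp_all add: field_simps)
qed

lemma half_power_less:
  assumes "(0::rat) < e"
  obtains n where "1 / 2 ^ n < e"
proof -
  obtain n where "1 / e < of_nat n" using reals_Archimedean2 by blast
  moreover have "(of_nat n :: rat) < 2 ^ n"
    using of_nat_less_iff[of n "2 ^ n", where 'a=rat] less_exp[of n] by simp
  ultimately have "1 / e < 2 ^ n" by linarith
  then show ?thesis using assms by (intro that[of n]) (simp add: field_simps)
qed

text \<open>Small one-sided neighbourhoods of 0 can be carried into any interval, because the orbit
  of 0 is dense.\<close>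

lemma zero_nbhd_to_interval:
  assumes "u < v"
  obtains q n where "q \<in> circle_group" "u < q 0" "q (1 / 2 ^ n) < v"
proof -
  obtain a n where x: "u < of_int a / 2 ^ n" "of_int a / 2 ^ n < v" using dyadic_between[OF assms] .
  obtain q where q: "q \<in> circle_group" "q (of_int a / 2 ^ n) = 0" using dyadic_to_zero by blast
  have "0 < q v" using aut_less[OF circle_group_aut[OF q(1)]] x q by metis
  then obtain n where n: "1 / 2 ^ n < q v" using half_power_less by blast
  show ?thesis
  proof (rule that)
    show "inv_fun q \<in> circle_group" using q circle_group_subgrp subgrpD by blast
    show "u < inv_fun q 0" using q x by (metis aut_inv1 circle_group_aut)
    show "inv_fun q (1 / 2 ^ n) < v" using n circle_group_aut[OF q(1)] by (metis aut_inv1 aut_inv aut_less)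
  qed
qed

abbreviation bumpZ :: "rat \<Rightarrow> rat" where
  "bumpZ \<equiv> spread UNIV bump"

lemma bumpZ_pow_zero: "(bumpZ ^^ n) 0 = 0"
  by (induction n) (simp_all add: bump_cell, simp add: bump_def)

lemma bumpZ_aut: "aut (bumpZ ^^ n)"
  using subgrp_funpow[OF circle_group_subgrp bump_circ] circle_group_aut by blast

lemma bumpZ_pow: "(bumpZ ^^ (n + 2)) (1 / 2 ^ (n + 3)) = 3 / 8"
proof (induction n)
  case 0
  have "bumpZ (1/8) = 1/4" "bumpZ (1/4) = 3/8" by (simp_all add: bump_cell) (simp_all add: bump_def)
  then have "bumpZ (bumpZ (1/8)) = 3/8" by metis
  then show ?case by (simp add: numeral_2_eq_2)
next
  case (Suc n)
  define y :: rat where "y = 1 / 2 ^ (Suc n + 3)"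
  define z :: rat where "z = 1 / 2 ^ n"
  have z: "y = z / 16" "z \<le> 1" "0 < z"
    by (simp_all add: y_def z_def power_add)
  have y: "0 < y" "y \<le> 1/8" using z by simp_all
  have y2: "2 * y = 1 / 2 ^ (n + 3)" by (simp add: y_def power_add)
  from y have "bumpZ (1 / 2 ^ (Suc n + 3)) = 1 / 2 ^ (n + 3)"
    unfolding y2[symmetric] y_def[symmetric] by (subst bump_cell) (auto simp: bump_def)
  then show ?case using Suc by (simp add: funpow_swap1)
qed

text \<open>The action on the circle is as contracting as possible: a proper arc \<open>[a, b]\<close> can be
  moved into any interval. The complementary gap is expanded first. Move a one-sided neighbourhood of 0
  into the gap and blow it up by powers of the bump; the gap then contains \<open>[0, 3/8]\<close>. One further
  expansion leaves an arc of length 3/8, which a rotation brings into \<open>[0, 3/8]\<close>; negative powers of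
  the bump contract it towards 0, and from there it can be carried anywhere.\<close>

lemma arc_into_interval:
  assumes "b < a + 1" "a < b" "u < v"
  obtains q where "q \<in> circle_group" "u < q a" "q b < v"
proof -
  have cp: "f \<circ> g \<in> circle_group" if "f \<in> circle_group" "g \<in> circle_group" for f g using that subgrpD(3)[OF circle_group_subgrp] by blast
  obtain q1 n where q1: "q1 \<in> circle_group" "b < q1 0" "q1 (1 / 2 ^ n) < a + 1"
    using zero_nbhd_to_interval[OF assms(1)] .
  define f1 where "f1 = inv_fun q1"
  have f1: "f1 \<in> circle_group" "f1 b < 0" "1 / 2 ^ n < f1 a + 1"
  proof -
    show "f1 \<in> circle_group" unfolding f1_def using q1 circle_group_subgrp subgrpD by blast
    have "q1 (f1 b) < q1 0" "q1 (1 / 2 ^ n) < q1 (f1 (a + 1))"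
      using q1 circle_group_aut[OF q1(1)] by (simp_all add: f1_def)
    then show "f1 b < 0" "1 / 2 ^ n < f1 a + 1"
      using aut_less[OF circle_group_aut[OF q1(1)]] circle_group_periodic[OF \<open>f1 \<in> circle_group\<close>] by (auto simp: periodic_def)
  qed
  define f2 where "f2 = bumpZ ^^ (n + 2)"
  have f2: "f2 \<in> circle_group" unfolding f2_def using subgrp_funpow[OF circle_group_subgrp bump_circ] .
  have "(1::rat) / 2 ^ (n + 3) < 1 / 2 ^ n" by (simp add: field_simps power_add)
  then have "f2 (1 / 2 ^ (n + 3)) < f2 (f1 a + 1)" using aut_less[OF circle_group_aut[OF f2]] f1 by simp
  then have a2: "3/8 < f2 (f1 a) + 1" using bumpZ_pow[of n] circle_group_periodic[OF f2] by (simp add: f2_def periodic_def)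
  have b2: "f2 (f1 b) < 0" using aut_less[OF circle_group_aut[OF f2], of "f1 b" 0] f1 bumpZ_pow_zero[of "n+2"] by (simp add: f2_def)
  obtain t where t: "t \<in> circle_group" "\<forall>x. t x = x + of_int 6 / 8" using rotation_circ by blast
  obtain t' where t': "t' \<in> circle_group" "\<forall>x. t' x = x + of_int (-3) / 8" using rotation_circ by blast
  \<comment> \<open>The bump shifted to \<open>[1/4, 3/4]\<close> moves 3/8 to 5/8 in two steps and fixes 0. It is
    followed by the rotation by 3/8.\<close>
  define f3 where "f3 = t' \<circ> bumpZ \<circ> bumpZ \<circ> t"
  have f3: "f3 \<in> circle_group" unfolding f3_def by (intro cp t t' bump_circ)
  have vals: "bumpZ (9/8) = 5/4" "bumpZ (5/4) = 11/8" "bumpZ (3/4) = 3/4"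
  proof -
    have "\<lfloor>9/8::rat\<rfloor> = 1" "\<lfloor>5/4::rat\<rfloor> = 1" "\<lfloor>3/4::rat\<rfloor> = 0" by (simp_all add: floor_eq_iff)
    then show "bumpZ (9/8) = 5/4" "bumpZ (5/4) = 11/8" "bumpZ (3/4) = 3/4"
      by (simp_all add: spread_def frac_def bump_def)
  qed
  have "t (3/8) = 9/8" "t 0 = 3/4" "t' (11/8) = 1" "t' (3/4) = 3/8" using t t' by simp_all
  then have "f3 (3/8) = 1" "f3 0 = 3/8" by (simp_all only: f3_def comp_apply vals)
  have a3: "0 < f3 (f2 (f1 a))"
    using a2 aut_less[OF circle_group_aut[OF f3], of "3/8" "f2 (f1 a) + 1"] circle_group_periodic[OF f3] \<open>f3 (3/8) = 1\<close>
    by (simp add: periodic_def)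
  have b3: "f3 (f2 (f1 b)) < 3/8"
    using b2 aut_less[OF circle_group_aut[OF f3], of "f2 (f1 b)" 0] \<open>f3 0 = 3/8\<close> by simp
  obtain q4 m where q4: "q4 \<in> circle_group" "u < q4 0" "q4 (1 / 2 ^ m) < v"
    using zero_nbhd_to_interval[OF assms(3)] .
  define f4 where "f4 = inv_fun (bumpZ ^^ (m + 2))"
  have f4: "f4 \<in> circle_group" "f4 0 = 0" "f4 (3/8) = 1 / 2 ^ (m + 3)"
    unfolding f4_def using subgrp_funpow[OF circle_group_subgrp bump_circ] subgrpD(4)[OF circle_group_subgrp]
      bumpZ_pow[of m] bumpZ_pow_zero[of "m + 2"] by (auto simp: aut_inv_eq_iff bumpZ_aut simp del: funpow.simps)
  have "0 < f4 (f3 (f2 (f1 a)))" "f4 (f3 (f2 (f1 b))) < 1 / 2 ^ (m + 3)"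
    using aut_less[OF circle_group_aut[OF f4(1)]] a3 b3 f4 by metis+
  moreover have "(1::rat) / 2 ^ (m + 3) < 1 / 2 ^ m" by (simp add: field_simps power_add)
  ultimately have "u < q4 (f4 (f3 (f2 (f1 a))))" "q4 (f4 (f3 (f2 (f1 b)))) < v"
    using aut_less[OF circle_group_aut[OF q4(1)]] q4 by (metis order.strict_trans)+
  then show ?thesis using that[of "q4 \<circ> f4 \<circ> f3 \<circ> f2 \<circ> f1"] by (simp add: cp q4 f4 f3 f2 f1)
qed

lemma J_into_interval:
  assumes "u < v"
  obtains q where "q \<in> circle_group" "\<And>x. x \<in> J \<Longrightarrow> u < q x \<and> q x < v"
proof -
  obtain q where q: "q \<in> circle_group" "u < q 0" "q (1/2) < v"
    using arc_into_interval[of "1/2" 0 u v] assms by auto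
  show ?thesis
  proof (rule that[OF q(1)])
    fix x assume "x \<in> J"
    then have "q 0 < q x" "q x < q (1/2)" using aut_less[OF circle_group_aut[OF q(1)]] by (auto simp: J_def)
    then show "u < q x \<and> q x < v" using q by linarith
  qed
qed

text \<open>An affine copy of the bump.\<close>

lemma bump_on_interval:
  assumes "u < v"
  obtains f where "aut f" "\<And>x. u < x \<Longrightarrow> x < v \<Longrightarrow> x < f x" "\<And>x. \<not> (u < x \<and> x < v) \<Longrightarrow> f x = x"
proof -
  define l where "l x = 2 * (v - u) * x + u" for x
  have l: "aut l" unfolding l_def using assms by (intro aut_affine) simp
  have l2: "l 0 = u" "l (1/2) = v" by (auto simp: l_def field_simps)
  have J: "inv_fun l x \<in> J \<longleftrightarrow> u < x \<and> x < v" for x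
    using aut_less[OF l, of 0 "inv_fun l x"] aut_less[OF l, of "inv_fun l x" "1/2"] l l2 by (simp add: J_def)
  show ?thesis
  proof (rule that[of "l \<circ> bump \<circ> inv_fun l"])
    show "aut (l \<circ> bump \<circ> inv_fun l)" using l autJ_bump by (simp add: autJ_aut)
    show "x < (l \<circ> bump \<circ> inv_fun l) x" if "u < x" "x < v" for x
      using aut_less[OF l, of "inv_fun l x" "bump (inv_fun l x)"] bump_gt J that l by simp
    show "(l \<circ> bump \<circ> inv_fun l) x = x" if "\<not> (u < x \<and> x < v)" for x
      using autJ_bump J that l by (simp add: autJ_def)
  qed
qed

text \<open>The rotation and the bump agree on \<open>[1/8, 1/4]\<close>, so that \<open>rot \<circ> inv_fun bumpZ\<close> is the identity on
  \<open>[1/4, 3/8]\<close>. Its support is therefore a proper arc, which some \<open>q\<close> squeezes into the half cell.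
  Hence the rotation is generated by conjugates of maps of the form \<open>spread UNIV r\<close>, and a normal
  subgroup that contains all of these contains the rotation.\<close>

lemma rotation_spread:
  obtains h r where "h \<in> circle_group" "autJ r" "rot = h \<circ> spread UNIV r \<circ> inv_fun h \<circ> bumpZ"
proof -
  define g where "g = rot \<circ> inv_fun bumpZ"
  have g: "g \<in> circle_group" unfolding g_def
    using rot_circ bump_circ subgrpD(3,4)[OF circle_group_subgrp] by blast
  have gfix: "g x = x" if "1/4 \<le> x" "x \<le> 3/8" for x
  proof -
    have "bumpZ (x - 1/8) = x" using that by (subst bump_cell) (auto simp: bump_def)
    then have "inv_fun bumpZ x = x - 1/8" by (simp add: aut_inv_eq_iff aut_spread autJ_bump)
    then show ?thesis by (simp add: g_def rot_def)
  qed
  obtain q where q: "q \<in> circle_group" "0 < q (3/8)" "q (5/4) < 1/2"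
    using arc_into_interval[of "5/4" "3/8" 0 "1/2"] by auto
  define h where "h = inv_fun q"
  have h: "h \<in> circle_group" unfolding h_def using q circle_group_subgrp subgrpD by blast
  define f where "f = q \<circ> g \<circ> h"
  have f: "f \<in> circle_group" unfolding f_def using q g h subgrpD(3)[OF circle_group_subgrp] by blast
  have "f x = x" if x: "0 \<le> x" "x < 1" "x \<notin> J" for x
  proof -
    have aq: "aut q" and pq: "periodic q" using q circle_group_aut circle_group_periodic by auto
    have "q (h x) = x" unfolding h_def using aq by simp
    have "x \<ge> 1/2 \<or> x = 0" using x by (auto simp: J_def)
    then consider "1/2 \<le> x" "x < 1" | "x = 0" using x by blast
    then have "\<exists>m::int. 1/4 \<le> h x + of_int m \<and> h x + of_int m \<le> 3/8"
    proof cases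
      case 1
      have "q (5/4) < q (h x)" "q (h x) < q (3/8) + 1" using 1 q \<open>q (h x) = x\<close> by simp_all
      moreover have "q (3/8) + 1 = q (11/8)" using spec[OF pq[unfolded periodic_def], of "3/8"] by simp
      ultimately have "5/4 < h x" "h x < 11/8" using aut_less[OF aq] by auto
      then show ?thesis by (intro exI[of _ "-1"]) simp
    next
      case 2
      have "q (5/4) < q (h x) + 1" "q (h x) < q (3/8)" using 2 q \<open>q (h x) = x\<close> by simp_all
      then have "5/4 < h x + 1" "h x < 3/8"
        using aut_less[OF aq, of "5/4" "h x + 1"] aut_less[OF aq, of "h x" "3/8"]
          spec[OF pq[unfolded periodic_def], of "h x"] by simp_all
      then show ?thesis by (intro exI[of _ 0]) simp
    qed
    then obtain m :: int where m: "1/4 \<le> h x + of_int m" "h x + of_int m \<le> 3/8" by blast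
    have "g (h x + of_int m) = h x + of_int m" using gfix m by blast
    then have "g (h x) = h x" using periodic_int[OF circle_group_periodic[OF g]] by simp
    then show ?thesis using \<open>q (h x) = x\<close> by (simp add: f_def)
  qed
  then obtain r where r: "autJ r" "f = spread UNIV r"
    using periodic_eq_spread[OF circle_group_aut[OF f] circle_group_periodic[OF f]] by blast
  have "rot = h \<circ> spread UNIV r \<circ> inv_fun h \<circ> bumpZ"
    unfolding r(2)[symmetric] f_def g_def h_def using circle_group_aut[OF q(1)]
    by (intro ext) (simp add: aut_spread autJ_bump)
  then show ?thesis using that h r by blast
qed

section \<open>An automorphism that contains copies of itself\<close>

text \<open>Disjoint copies \<open>e i n ` J\<close> of the half cell inside the half cell are given. An
  automorphism \<open>self\<close> is sought that acts on all copies in row \<open>i + 1\<close> like \<open>q i\<close>, and on all copies in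
  row 0 like \<open>self\<close>. Unfolding this recursive demand along words of indices yields an explicit
  solution: on the copy reached by descending through row 0 finitely often and then into row
  \<open>i + 1\<close>, it acts as \<open>q i\<close>. Points that stay in row 0 forever are fixed.\<close>

locale self_similar =
  fixes e :: "nat \<Rightarrow> nat \<Rightarrow> rat \<Rightarrow> rat" and q :: "nat \<Rightarrow> rat \<Rightarrow> rat"
  assumes e_aut: "aut (e i n)"
    and e_J: "x \<in> J \<Longrightarrow> e i n x \<in> J"
    and e_disjoint: "x \<in> J \<Longrightarrow> y \<in> J \<Longrightarrow> e i n x = e j m y \<Longrightarrow> i = j \<and> n = m"
    and q_autJ: "autJ (q i)"
begin

fun descend :: "nat list \<Rightarrow> rat \<Rightarrow> rat" where
  "descend [] = id"
| "descend (n # w) = e 0 n \<circ> descend w"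

definition place :: "nat list \<times> nat \<times> nat \<Rightarrow> rat \<Rightarrow> rat" where
  "place = (\<lambda>(w, i, n). descend w \<circ> e (Suc i) n)"

lemma descend_aut: "aut (descend w)"
  by (induction w) (auto intro: e_aut aut_comp simp del: comp_apply)

lemma place_aut: "aut (place a)"
  by (cases a) (simp add: place_def descend_aut e_aut)

lemma descend_J: "x \<in> J \<Longrightarrow> descend w x \<in> J"
  by (induction w) (auto intro: e_J)

lemma place_J: "x \<in> J \<Longrightarrow> place a x \<in> J"
  by (cases a) (simp add: place_def descend_J e_J)

lemma place_Nil: "place ([], i, n) x = e (Suc i) n x"
  and place_Cons: "place (m # w, i, n) x = e 0 m (place (w, i, n) x)"
  by (simp_all add: place_def)

text \<open>The words that descend through row 0 and end in another row form a prefix code.\<close>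

lemma place_disjoint:
  "x \<in> J \<Longrightarrow> y \<in> J \<Longrightarrow> place (w, i, n) x = place (w', i', n') y \<Longrightarrow> (w, i, n) = (w', i', n')"
proof (induction w arbitrary: w')
  case Nil
  show ?case
  proof (cases w')
    case w': Nil
    then show ?thesis using Nil e_disjoint[OF Nil(1,2)] by (auto simp: place_Nil)
  next
    case (Cons m v)
    then show ?thesis
      using Nil e_disjoint[OF Nil(1) place_J[OF Nil(2)], of "Suc i" n 0 m "(v, i', n')"]
      by (simp add: place_Nil place_Cons)
  qed
next
  case (Cons m w)
  show ?case
  proof (cases w')
    case Nil
    then show ?thesis
      using Cons.prems e_disjoint[OF place_J[OF Cons.prems(1)] Cons.prems(2), of 0 m "(w, i, n)" "Suc i'" n']
      by (simp add: place_Nil place_Cons)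
  next
    case (Cons m' v)
    then have "m = m'"
      using Cons.prems e_disjoint[OF place_J place_J] by (auto simp: place_Cons)
    moreover from this have "place (w, i, n) x = place (v, i', n') y"
      using Cons Cons.prems aut_eq[OF e_aut] by (simp add: place_Cons)
    ultimately show ?thesis using Cons.IH Cons Cons.prems by auto
  qed
qed

definition self :: "rat \<Rightarrow> rat" where
  "self x = (if \<exists>a. x \<in> place a ` J
     then case THE a. x \<in> place a ` J of (w, i, n) \<Rightarrow> place (w, i, n) (q i (inv_fun (place (w, i, n)) x))
     else x)"

lemma place_unique: "x \<in> place a ` J \<Longrightarrow> x \<in> place b ` J \<Longrightarrow> a = b"
  using place_disjoint by (cases a, cases b) blast

lemma self_place:
  assumes "y \<in> J"
  shows "self (place (w, i, n) y) = place (w, i, n) (q i y)"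
proof -
  have "(THE a. place (w, i, n) y \<in> place a ` J) = (w, i, n)"
    using assms by (intro the_equality) (blast, metis place_unique imageI)
  moreover have "\<exists>a. place (w, i, n) y \<in> place a ` J" using assms by blast
  ultimately show ?thesis by (simp add: self_def place_aut)
qed

lemma self_off: "(\<And>a. x \<notin> place a ` J) \<Longrightarrow> self x = x"
  by (simp add: self_def)

lemma self_autJ: "autJ self"
proof -
  have "aut self"
  proof (rule aut_glue)
    let ?F = "\<lambda>a. place a \<circ> q (fst (snd a)) \<circ> inv_fun (place a)"
    show "aut (?F a)" for a
      using place_aut q_autJ by (intro aut_comp) (auto simp: autJ_aut)
    show "?F a x = x" if "x \<notin> place a ` J" for a x
    proof -
      have "inv_fun (place a) x \<notin> J" using that place_aut[of a] by (metis aut_inv2 imageI)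
      then show ?thesis using q_autJ place_aut by (simp add: autJ_def)
    qed
    show "self x = ?F a x" if "x \<in> place a ` J" for a x
      using that self_place place_aut by (cases a) auto
    show "a = b" if "x \<in> place a ` J" "x \<in> place b ` J" for a b x
      using that by (rule place_unique)
    show "self x = x" if "\<And>a. x \<notin> place a ` J" for x
      using that by (rule self_off)
  qed
  moreover have "self x = x" if "x \<notin> J" for x
    using that place_J by (intro self_off) auto
  ultimately show ?thesis by (simp add: autJ_def)
qed

text \<open>The recursive demand is satisfied.\<close>

lemma self_copy:
  assumes "y \<in> J"
  shows "self (e i n y) = e i n (case i of 0 \<Rightarrow> self y | Suc j \<Rightarrow> q j y)"
proof (cases i)
  case (Suc j)
  then show ?thesis using self_place[OF assms, of "[]" j n] by (simp add: place_Nil)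
next
  case 0
  show ?thesis
  proof (cases "\<exists>a. y \<in> place a ` J")
    case True
    then obtain w j m z where z: "z \<in> J" "y = place (w, j, m) z" by auto
    then show ?thesis using self_place[OF z(1), of w j m] self_place[OF z(1), of "n # w" j m] 0
      by (simp add: place_Cons)
  next
    case False
    have "e 0 n y \<notin> place (w, j, m) ` J" for w j m
    proof
      assume "e 0 n y \<in> place (w, j, m) ` J"
      then obtain z where z: "z \<in> J" "e 0 n y = place (w, j, m) z" by blast
      show False
      proof (cases w)
        case Nil
        then show False using e_disjoint[OF assms z(1), of 0 n "Suc j" m] z by (simp add: place_Nil)
      next
        case (Cons n' v)
        then have "e 0 n y = e 0 n' (place (v, j, m) z)" using z by (simp add: place_Cons)
        moreover from this have "n = n'" using e_disjoint[OF assms place_J[OF z(1)]] by blast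
        ultimately have "y = place (v, j, m) z" using aut_eq[OF e_aut] by simp
        then show False using False z by blast
      qed
    qed
    then have "self (e 0 n y) = e 0 n y" by (intro self_off) auto
    then show ?thesis using 0 False self_off by auto
  qed
qed

lemma self_off_copies:
  assumes "\<And>i n. x \<notin> e i n ` J"
  shows "self x = x"
proof (rule self_off)
  fix a :: "nat list \<times> nat \<times> nat"
  obtain w i n where a: "a = (w, i, n)" by (cases a)
  show "x \<notin> place a ` J"
  proof
    assume "x \<in> place a ` J"
    then obtain z where z: "z \<in> J" "x = place (w, i, n) z" using a by blast
    then show False
    proof (cases w)
      case (Cons m v)
      then show False using z assms[of 0 m] place_J[OF z(1)] by (auto simp: place_Cons)
    qed (use z assms[of "Suc i" n] in \<open>simp add: place_Nil\<close>)
  qed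
qed

end

lemma increasing_orbit:
  fixes f :: "rat \<Rightarrow> rat"
  assumes f: "aut f" and y: "y < f y"
    and x: "(f ^^ i) y < x" "x < (f ^^ Suc i) y" "(f ^^ j) y < x" "x < (f ^^ Suc j) y"
  shows "i = j"
proof -
  have "strict_mono (\<lambda>i. (f ^^ i) y)"
  proof (rule strict_mono_Suc_iff[THEN iffD2], rule allI)
    show "(f ^^ n) y < (f ^^ Suc n) y" for n
      by (induction n) (use y in \<open>simp_all add: aut_less[OF f]\<close>)
  qed
  then have m: "(f ^^ a) y < (f ^^ b) y \<longleftrightarrow> a < b" for a b by (rule strict_mono_less)
  have "i < Suc j" "j < Suc i" using x m[of i "Suc j"] m[of j "Suc i"] by (meson order.strict_trans)+
  then show ?thesis by simp
qed

lemma aut_funpow: "aut f \<Longrightarrow> aut (f ^^ n)"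
  by (induction n) auto

lemma autJ_funpow: "autJ f \<Longrightarrow> autJ (f ^^ n)"
  by (induction n) auto

text \<open>Any sequence \<open>g\<close> of automorphisms of the half cell can be encoded in a sequence \<open>p\<close>
  such that the first three terms generate compressed copies of all terms, and even as commutators.
  Take for \<open>p 1\<close> a bump \<open>s\<close> that moves \<open>c ` J\<close> off itself, and for \<open>p 0\<close> an automorphism that repeats
  \<open>p i\<close> along the orbit of \<open>c ` J\<close> under \<open>s\<close>, inside the \<open>i\<close>-th translate of a fundamental domain of
  the bump \<open>p 2\<close>. Conjugation by a power of \<open>p 2\<close> brings the \<open>i\<close>-th row to the support of \<open>s\<close>, and the
  commutator with \<open>s\<close> cancels all copies of \<open>p i\<close> in that row except the first one. Since \<open>p 0\<close> is
  itself among the encoded automorphisms, it has to contain copies of itself.\<close>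

lemma self_encoding:
  fixes g :: "nat \<Rightarrow> rat \<Rightarrow> rat"
  assumes g: "\<And>i. autJ (g i)"
  obtains p c where "c \<in> circle_group" "\<forall>x\<in>J. c x \<in> J" "\<forall>i. autJ (p i)"
    "p 2 = bump" "\<forall>i. p (i + 3) = g i"
    "\<forall>i. \<exists>a\<in>gen {p 0, p 1, p 2}. c \<circ> p i \<circ> inv_fun c = a \<circ> p 1 \<circ> inv_fun a \<circ> inv_fun (p 1)"
proof -
  \<comment> \<open>\<open>(1/8, 1/4)\<close> is, up to an endpoint, a fundamental domain for the bump acting on \<open>J\<close>.\<close>
  define y0 :: rat where "y0 = 1/8"
  define y1 :: rat where "y1 = 1/4"
  have bump_y: "bump y0 = y1" "y0 < y1" by (simp_all add: y0_def y1_def bump_def)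
  obtain s where s: "aut s" "\<And>x. y0 < x \<Longrightarrow> x < y1 \<Longrightarrow> x < s x" "\<And>x. \<not> (y0 < x \<and> x < y1) \<Longrightarrow> s x = x"
    using bump_on_interval[OF bump_y(2)] by blast
  \<comment> \<open>Any point of the fundamental domain would do.\<close>
  define z0 :: rat where "z0 = 3/16"
  have z0: "y0 < z0" "z0 < y1" by (simp_all add: y0_def y1_def z0_def)
  define I where "I = {x. y0 < x \<and> x < y1}"
  have sI: "s x \<in> I \<longleftrightarrow> x \<in> I" for x
  proof -
    have fix_s: "s z = z" if "z \<notin> I" for z using s(3)[of z] that by (simp add: I_def)
    show ?thesis using aut_image_support[OF s(1) fix_s] fix_s by (cases "x \<in> I") auto
  qed
  have snI: "(s ^^ n) x \<in> I \<longleftrightarrow> x \<in> I" for n x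
    by (induction n) (simp_all add: sI)
  have IJ: "x \<in> I \<Longrightarrow> x \<in> J" for x by (simp add: I_def J_def y0_def y1_def)
  have sJ: "autJ s" unfolding autJ_def using s IJ by (auto simp: I_def)
  obtain c where c: "c \<in> circle_group" "\<And>x. x \<in> J \<Longrightarrow> z0 < c x \<and> c x < s z0"
    using J_into_interval[of z0 "s z0"] s(2)[OF z0] by blast
  have cI: "c x \<in> I" if "x \<in> J" for x
  proof -
    have "s z0 < y1" using sI[of z0] z0 by (simp add: I_def)
    then show ?thesis using c(2)[OF that] z0 by (simp add: I_def)
  qed
  have ac: "aut c" using c circle_group_aut by blast
  define e where "e i n = (bump ^^ i) \<circ> (s ^^ n) \<circ> c" for i n
  define q where "q i = (case i of 0 \<Rightarrow> s | Suc 0 \<Rightarrow> bump | Suc (Suc j) \<Rightarrow> g j)" for i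
  have abn: "aut (bump ^^ i)" "aut (s ^^ n)" for i n
    using aut_funpow autJ_bump s autJ_aut by blast+
  have sn_disj: "n = m" if "x \<in> J" "y \<in> J" "(s ^^ n) (c x) = (s ^^ m) (c y)" for n m x y
  proof -
    have "(s ^^ n) z0 < (s ^^ n) (c x)" "(s ^^ n) (c x) < (s ^^ Suc n) z0"
      using c(2)[OF that(1)] aut_less[OF abn(2)] by (simp_all add: funpow_swap1)
    moreover have "(s ^^ m) z0 < (s ^^ m) (c y)" "(s ^^ m) (c y) < (s ^^ Suc m) z0"
      using c(2)[OF that(2)] aut_less[OF abn(2)] by (simp_all add: funpow_swap1)
    ultimately show ?thesis
      using increasing_orbit[OF s(1) s(2)[OF z0]] that(3) by metis
  qed
  have bn_disj: "i = j" if "x \<in> I" "y \<in> I" "(bump ^^ i) x = (bump ^^ j) y" for i j x y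
  proof -
    have "(bump ^^ i) y0 < (bump ^^ i) x" "(bump ^^ i) x < (bump ^^ Suc i) y0"
      using that(1) aut_less[OF abn(1)] bump_y by (simp_all add: funpow_swap1 I_def)
    moreover have "(bump ^^ j) y0 < (bump ^^ j) y" "(bump ^^ j) y < (bump ^^ Suc j) y0"
      using that(2) aut_less[OF abn(1)] bump_y by (simp_all add: funpow_swap1 I_def)
    ultimately show ?thesis
      using increasing_orbit[OF autJ_aut[OF autJ_bump]] bump_y that(3) by metis
  qed
  interpret self_similar e q
  proof
    show "aut (e i n)" for i n unfolding e_def using abn ac by simp
    show "e i n x \<in> J" if "x \<in> J" for i n x
      using that cI IJ snI autJ_J[OF autJ_funpow[OF autJ_bump]] by (simp add: e_def)
    show "i = j \<and> n = m" if xy: "x \<in> J" "y \<in> J" "e i n x = e j m y" for i n j m x y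
    proof -
      have "i = j" using bn_disj[of "(s ^^ n) (c x)" "(s ^^ m) (c y)" i j] xy snI cI by (simp add: e_def)
      moreover from this have "n = m" using sn_disj xy aut_eq[OF abn(1)] by (simp add: e_def)
      ultimately show ?thesis ..
    qed
    show "autJ (q i)" for i
      using sJ autJ_bump g by (simp add: q_def split: nat.split)
  qed
  define p where "p i = (case i of 0 \<Rightarrow> self | Suc j \<Rightarrow> q j)" for i
  have pJ: "autJ (p i)" for i using self_autJ q_autJ by (simp add: p_def split: nat.split)
  have copy: "self (e i n y) = e i n (p i y)" if "y \<in> J" for i n y
    using self_copy[OF that] by (simp add: p_def split: nat.split)
  have p1: "p 1 = s" and p2: "p 2 = bump" by (simp_all add: p_def q_def numeral_2_eq_2)
  let ?K = "gen {p 0, p 1, p 2}"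
  have K: "subgrp ?K" by (rule subgrp_gen) (use pJ autJ_aut in blast)
  have compressed: "\<exists>a\<in>?K. c \<circ> p i \<circ> inv_fun c = a \<circ> p 1 \<circ> inv_fun a \<circ> inv_fun (p 1)" for i
  proof
    define b where "b = bump ^^ i"
    have b: "b \<in> ?K" unfolding b_def
      using subgrp_funpow[OF K gen_base[of "p 2"]] p2 by simp
    have ab: "aut b" using abn b_def by simp
    \<comment> \<open>Row \<open>i\<close> of \<open>self\<close>, moved to the fundamental domain.\<close>
    define a where "a = inv_fun b \<circ> self \<circ> b"
    show aK: "a \<in> ?K"
      unfolding a_def using b subgrpD(3,4)[OF K] gen_base[of "p 0" "{p 0, p 1, p 2}"] by (simp add: p_def)
    have aa: "aut a" using aK subgrpD(1)[OF K] by blast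
    have a_copy: "a ((s ^^ n) (c y)) = (s ^^ n) (c (p i y))" if "y \<in> J" for n y
      using copy[OF that, of i n] ab by (simp add: a_def e_def b_def aut_inv_eq_iff)
    have a_off: "a x = x" if x: "x \<in> I" "\<And>n y. y \<in> J \<Longrightarrow> x \<noteq> (s ^^ n) (c y)" for x
    proof -
      have "b x \<notin> e j n ` J" for j n
      proof
        assume "b x \<in> e j n ` J"
        then obtain y where y: "y \<in> J" "b x = e j n y" by blast
        then have "i = j" using bn_disj[OF x(1), of "(s ^^ n) (c y)" i j] snI cI by (simp add: e_def b_def)
        then show False using y x(2)[OF y(1), of n] aut_eq[OF abn(1)] by (simp add: e_def b_def)
      qed
      then have "self (b x) = b x" by (rule self_off_copies)
      then show ?thesis using ab by (simp add: a_def)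
    qed
    have aI_sub: "a x \<in> I" if "x \<in> I" for x
    proof (cases "\<exists>n. \<exists>y\<in>J. x = (s ^^ n) (c y)")
      case True
      then show ?thesis using a_copy snI cI autJ_J[OF pJ] by auto
    next
      case False
      then show ?thesis using a_off[OF that] that by metis
    qed
    define t where "t = c \<circ> p i \<circ> inv_fun c"
    have t_c: "t (c y) = c (p i y)" for y using ac by (simp add: t_def)
    have t_off: "t x = x" if "x \<notin> c ` J" for x
    proof -
      have "inv_fun c x \<notin> J" using that ac by (metis aut_inv2 imageI)
      then show ?thesis using pJ[of i] ac by (simp add: t_def autJ_def)
    qed
    have ta: "aut t" unfolding t_def using ac autJ_aut[OF pJ] by simp
    \<comment> \<open>The commutator identity, without inverses: on the copy number \<open>n\<close> both sides move by \<open>p i\<close> and on to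
      copy \<open>n + 1\<close>; the factor \<open>t\<close> supplies \<open>p i\<close> on the first copy, which \<open>s\<close> reaches from a place
      where \<open>a\<close> is trivial.\<close>
    have main: "a (s x) = t (s (a x))" for x
    proof (cases "x \<in> I")
      case False
      have "a x \<notin> I"
      proof
        assume "a x \<in> I"
        have "inv_fun a (a x) \<in> I"
        proof (cases "\<exists>n. \<exists>y\<in>J. a x = (s ^^ n) (c y)")
          case True
          then obtain n y where y: "y \<in> J" "a x = (s ^^ n) (c y)" by blast
          let ?y = "inv_fun (p i) y"
          have "?y \<in> J" "p i ?y = y"
            using y autJ_J[OF autJ_inv[OF pJ[of i]]] aut_inv2[OF autJ_aut[OF pJ[of i]]] by auto
          then have "a x = a ((s ^^ n) (c ?y))" using a_copy y by simp
          then have "x = (s ^^ n) (c ?y)" using aut_eq[OF aa] by blast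
          then show ?thesis using snI[of n "c ?y"] cI[OF \<open>?y \<in> J\<close>] aa by simp
        next
          case False2: False
          then have "a (a x) = a x" using a_off[OF \<open>a x \<in> I\<close>] by metis
          then have "x \<in> I" using aut_eq[OF aa] \<open>a x \<in> I\<close> by simp
          then show ?thesis by (simp only: aut_inv1[OF aa])
        qed
        then show False using False aa by simp
      qed
      then have "a x \<notin> c ` J" by (metis cI imageE)
      then have "t (a x) = a x" by (rule t_off)
      moreover have "s (a x) = a x" using s(3)[of "a x"] \<open>a x \<notin> I\<close> by (simp add: I_def)
      ultimately have "t (s (a x)) = a x" by simp
      then show ?thesis using False s(3)[of x] by (auto simp: I_def)
    next
      case True
      show ?thesis
      proof (cases "\<exists>n. \<exists>y\<in>J. x = (s ^^ n) (c y)")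
        case True2: True
        then obtain n y where y: "y \<in> J" "x = (s ^^ n) (c y)" by blast
        have "p i y \<in> J" using y autJ_J[OF pJ] by simp
        have "s (a x) = (s ^^ Suc n) (c (p i y))" using a_copy[OF y(1), of n] y by simp
        moreover have "(s ^^ Suc n) (c (p i y)) \<notin> c ` J"
          using sn_disj[OF \<open>p i y \<in> J\<close>, of _ "Suc n" 0] by auto
        ultimately have "t (s (a x)) = (s ^^ Suc n) (c (p i y))" using t_off by simp
        then show ?thesis using a_copy[OF y(1), of "Suc n"] y by simp
      next
        case False
        then have ax: "a x = x" using a_off[OF True] by metis
        show ?thesis
        proof (cases "\<exists>n. \<exists>y\<in>J. s x = (s ^^ n) (c y)")
          case False2: False
          then have "a (s x) = s x" using a_off[of "s x"] sI True by metis
          moreover have "s x \<notin> c ` J" using False2 by (metis funpow_0 imageE)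
          ultimately show ?thesis using t_off ax by simp
        next
          case True3: True
          then obtain n y where y: "y \<in> J" "s x = (s ^^ n) (c y)" by blast
          have "n = 0"
          proof (rule ccontr)
            assume "n \<noteq> 0"
            then obtain m where "n = Suc m" using not0_implies_Suc by blast
            then have "x = (s ^^ m) (c y)" using y aut_eq[OF s(1)] by simp
            then show False using False y by blast
          qed
          then show ?thesis using y a_copy[OF y(1), of 0] t_c ax by simp
        qed
      qed
    qed
    show "c \<circ> p i \<circ> inv_fun c = a \<circ> p 1 \<circ> inv_fun a \<circ> inv_fun (p 1)"
      unfolding t_def[symmetric] p1
    proof
      fix x
      have "a (s (inv_fun a (inv_fun s x))) = t x"
        using main[of "inv_fun a (inv_fun s x)"] aa s(1) by simp
      then show "t x = (a \<circ> s \<circ> inv_fun a \<circ> inv_fun s) x" by simp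
    qed
  qed
  show ?thesis
  proof (rule that[of c p])
    show "\<forall>i. p (i + 3) = g i"
      by (simp add: p_def q_def numeral_3_eq_3)
    show "\<forall>x\<in>J. c x \<in> J" using cI IJ by blast
    show "\<forall>i. \<exists>a\<in>?K. c \<circ> p i \<circ> inv_fun c = a \<circ> p 1 \<circ> inv_fun a \<circ> inv_fun (p 1)"
      by (rule allI) (rule compressed)
  qed (simp_all add: c pJ p2)
qed

section \<open>An aperiodic Toeplitz set of integers\<close>

text \<open>The set underlying the period doubling sequence. It decides which cells are marked.\<close>

definition W :: "int set" where
  "W = {n. n = 0 \<or> even (multiplicity 2 n)}"

lemma multiplicity_two_odd: "odd (u::int) \<Longrightarrow> multiplicity 2 (2 ^ e * u) = e"
  by (rule multiplicity_eqI) auto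

lemma odd_part:
  assumes "(n::int) \<noteq> 0"
  obtains e u where "n = 2 ^ e * u" "odd u"
proof -
  have "\<not> is_unit (2::int)" by simp
  then obtain u where "n = 2 ^ multiplicity 2 n * u" "odd u"
    by (rule multiplicity_decompose'[OF assms])
  then show ?thesis by (rule that)
qed

lemma W_power: "odd u \<Longrightarrow> 2 ^ e * u \<in> W \<longleftrightarrow> even e"
  by (auto simp: W_def multiplicity_two_odd)

text \<open>With \<open>d = 2 ^ e * u\<close> and \<open>u\<close> odd, the valuations of \<open>2 ^ (e + 1) - d\<close> and of \<open>2 ^ (e + 1)\<close> differ by one.\<close>

lemma W_aperiodic:
  assumes "d \<noteq> 0"
  shows "\<exists>j. (j \<in> W) \<noteq> (j + d \<in> W)"
proof -
  obtain e u where d: "d = 2 ^ e * u" "odd u" using odd_part[OF assms] .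
  have "2 ^ e * (2 - u) \<in> W \<longleftrightarrow> even e" using d by (intro W_power) simp
  moreover have "2 ^ e * (2 - u) + d = 2 ^ Suc e * 1" by (simp add: d algebra_simps)
  moreover have "2 ^ Suc e * 1 \<in> W \<longleftrightarrow> odd e" using W_power[of 1 "Suc e"] by simp
  ultimately show ?thesis by metis
qed

text \<open>The translations that preserve the marking of the cells in the window \<open>F\<close>.\<close>

definition pattern :: "int set \<Rightarrow> int set" where
  "pattern F = {d. \<forall>j\<in>F. j \<in> W \<longleftrightarrow> j + d \<in> W}"

lemma pattern_mono: "F \<subseteq> F' \<Longrightarrow> pattern F' \<subseteq> pattern F"
  by (auto simp: pattern_def)

text \<open>Every finite pattern of marks recurs along a whole residue class. Adding a multiple of
  a high power of 2 does not change the valuation of a small nonzero number, and the number 0, which is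
  marked by convention, is replaced by an odd multiple of \<open>2 ^ M\<close>. The latter is marked if
  \<open>M\<close> is even.\<close>

lemma pattern_residue_class:
  assumes "finite F"
  obtains a k where "0 < k" "\<And>t. a + k * t \<in> pattern F"
proof -
  define M where "M = 2 * nat (\<Sum>j\<in>F. \<bar>j\<bar>)"
  have M: "\<bar>j\<bar> < 2 ^ M" if "j \<in> F" for j
  proof -
    have "\<bar>j\<bar> \<le> (\<Sum>j\<in>F. \<bar>j\<bar>)" using assms that by (intro member_le_sum) auto
    then have "\<bar>j\<bar> \<le> int M" by (simp add: M_def)
    also have "\<dots> < 2 ^ M" using of_nat_less_iff[of M "2 ^ M", where 'a=int] less_exp[of M] by simp
    finally show ?thesis .
  qed
  have "2 ^ M + 2 ^ Suc M * t \<in> pattern F" for t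
    unfolding pattern_def
  proof (rule CollectI, rule ballI)
    fix j assume j: "j \<in> F"
    have eq: "2 ^ M + 2 ^ Suc M * t = 2 ^ M * (1 + 2 * t)" by (simp add: algebra_simps)
    show "j \<in> W \<longleftrightarrow> j + (2 ^ M + 2 ^ Suc M * t) \<in> W"
    proof (cases "j = 0")
      case True
      have "2 ^ M * (1 + 2 * t) \<in> W" by (subst W_power) (simp_all add: M_def)
      then show ?thesis using True eq by (simp add: W_def)
    next
      case False
      obtain e u where d: "j = 2 ^ e * u" "odd u" using odd_part[OF False] .
      have "1 \<le> \<bar>u\<bar>" using d by (cases "u = 0") auto
      then have "2 ^ e * 1 \<le> \<bar>j\<bar>" unfolding d abs_mult by (intro mult_mono) auto
      then have "(2::int) ^ e < 2 ^ M" using M[OF j] by linarith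
      then have "e < M" by simp
      then have "(2::int) ^ M = 2 ^ e * (2 * 2 ^ (M - Suc e))"
        by (simp flip: power_add power_Suc)
      then have "j + (2 ^ M + 2 ^ Suc M * t) = 2 ^ e * (u + 2 * (2 ^ (M - Suc e) * (1 + 2 * t)))"
        unfolding eq d by (simp add: algebra_simps)
      then show ?thesis using W_power[of u e] W_power[of "u + 2 * (2 ^ (M - Suc e) * (1 + 2 * t))" e] d by simp
    qed
  qed
  then show ?thesis using that[of "2 ^ Suc M" "2 ^ M"] by simp
qed

section \<open>The simple group\<close>

lemma disjoint_supports_commute:
  assumes "aut f" "aut g" "\<And>x. x \<notin> S \<Longrightarrow> f x = x" "\<And>x. x \<in> S \<Longrightarrow> g x = x"
  shows "f (g x) = g (f x)"
proof (cases "x \<in> S")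
  case True
  then show ?thesis using aut_image_support[OF assms(1,3)] assms(4) by simp
next
  case False
  then have "g x \<notin> S" using aut_image_support[OF assms(2), of "- S" x] assms(4) by simp
  then show ?thesis using False assms(3) by simp
qed

text \<open>The data provided by the two previous constructions. The terms from \<open>p 4\<close> on
  carry the group that is to be embedded.\<close>

locale simple_construction =
  fixes p :: "nat \<Rightarrow> rat \<Rightarrow> rat" and c h :: "rat \<Rightarrow> rat"
  assumes c: "c \<in> circle_group" "\<And>x. x \<in> J \<Longrightarrow> c x \<in> J"
    and p_autJ: "autJ (p i)" and p2: "p 2 = bump"
    and compressed: "\<exists>a\<in>gen {p 0, p 1, p 2}. c \<circ> p i \<circ> inv_fun c = a \<circ> p 1 \<circ> inv_fun a \<circ> inv_fun (p 1)"
    and h: "h \<in> circle_group" "rot = h \<circ> spread UNIV (p 3) \<circ> inv_fun h \<circ> spread UNIV bump"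
begin

definition S :: "(rat \<Rightarrow> rat) set" where
  "S = insert rot (spread UNIV ` {p 0, p 1, p 2} \<union> spread W ` {p 0, p 1, p 2})"

definition H :: "(rat \<Rightarrow> rat) set" where
  "H = gen S"

lemma S_aut: "f \<in> S \<Longrightarrow> aut f"
  by (auto simp: S_def rot_aut aut_spread p_autJ)

lemma H_subgrp: "subgrp H"
  unfolding H_def by (rule subgrp_gen) (blast intro: S_aut)

lemma circle_group_H: "circle_group \<subseteq> H"
  unfolding circle_group_def
  by (rule gen_le[OF H_subgrp]) (auto simp: H_def S_def p2[symmetric] intro: gen_base)

definition normalH :: "(rat \<Rightarrow> rat) set \<Rightarrow> bool" where
  "normalH N \<longleftrightarrow> subgrp N \<and> N \<subseteq> H \<and> (\<forall>f\<in>H. \<forall>n\<in>N. f \<circ> n \<circ> inv_fun f \<in> N)"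

lemma normalH_H: "normalH H"
  using H_subgrp subgrp_conj by (auto simp: normalH_def)

lemma normalH_subgrp: "normalH N \<Longrightarrow> subgrp N"
  and normalH_conj: "normalH N \<Longrightarrow> f \<in> H \<Longrightarrow> n \<in> N \<Longrightarrow> f \<circ> n \<circ> inv_fun f \<in> N"
  by (simp_all add: normalH_def)

lemma normalH_unconj:
  assumes "normalH N" "f \<in> H" "f \<circ> n \<circ> inv_fun f \<in> N"
  shows "n \<in> N"
proof -
  have f: "inv_fun f \<in> H" "aut f" using assms(2) subgrpD[OF H_subgrp] by auto
  have "inv_fun f \<circ> (f \<circ> n \<circ> inv_fun f) \<circ> inv_fun (inv_fun f) \<in> N"
    using normalH_conj[OF assms(1) f(1) assms(3)] .
  moreover have "inv_fun f \<circ> (f \<circ> n \<circ> inv_fun f) \<circ> inv_fun (inv_fun f) = n"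
    using f(2) by (intro ext) simp
  ultimately show ?thesis by simp
qed

lemma normalH_commutator:
  assumes "normalH N" "n \<in> N" "f \<in> H"
  shows "n \<circ> f \<circ> inv_fun n \<circ> inv_fun f \<in> N"
proof -
  have "inv_fun n \<in> N" using subgrpD(4)[OF normalH_subgrp[OF assms(1)]] assms(2) .
  then have "f \<circ> inv_fun n \<circ> inv_fun f \<in> N" by (rule normalH_conj[OF assms(1,3)])
  then have "n \<circ> (f \<circ> inv_fun n \<circ> inv_fun f) \<in> N" by (rule subgrpD(3)[OF normalH_subgrp[OF assms(1)] assms(2)])
  then show ?thesis by (simp add: comp_assoc)
qed

text \<open>For fixed \<open>N\<close>, the sets \<open>C\<close> with this property form a translation invariant ideal in the
  collection of those for \<open>N = H\<close>, which is a Boolean algebra containing the set of marked cells.\<close>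

definition spreads_in :: "(rat \<Rightarrow> rat) set \<Rightarrow> int set \<Rightarrow> bool" where
  "spreads_in N C \<longleftrightarrow> (\<forall>i. spread C (p i) \<in> N)"

lemma spread_gen:
  assumes "subgrp K" "spread C ` {p 0, p 1, p 2} \<subseteq> K" "a \<in> gen {p 0, p 1, p 2}"
  shows "autJ a \<and> spread C a \<in> K"
proof -
  have "subgrp {a. autJ a \<and> spread C a \<in> K}"
    unfolding subgrp_def using subgrpD[OF assms(1)]
    by (auto simp: autJ_aut simp flip: spread_comp inv_spread)
  then have "gen {p 0, p 1, p 2} \<subseteq> {a. autJ a \<and> spread C a \<in> K}"
    by (rule gen_le) (use assms(2) p_autJ in auto)
  then show ?thesis using assms(3) by blast
qed

text \<open>A compressed copy suffices, since the compression \<open>c\<close> belongs to \<open>H\<close>.\<close>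

lemma spreads_in_contract:
  assumes N: "normalH N" and "spread C (c \<circ> p i \<circ> inv_fun c) \<in> N"
  shows "spread C (p i) \<in> N"
  using assms(2) conj_spread[OF p_autJ circle_group_aut[OF c(1)] circle_group_periodic[OF c(1)] c(2)]
    normalH_unconj[OF N] c(1) circle_group_H by (metis subsetD)

text \<open>A compressed copy of \<open>p i\<close> is a commutator of elements generated by the first three
  terms. Performing one of the two entries in \<open>C\<close> and the other one in \<open>D\<close> yields the compressed copy in
  \<open>C \<inter> D\<close>.\<close>

lemma spreads_in_Int:
  assumes N: "normalH N" and C: "spread C ` {p 0, p 1, p 2} \<subseteq> N" and D: "spread D (p 1) \<in> H"
  shows "spreads_in N (C \<inter> D)"
  unfolding spreads_in_def
proof
  fix i
  obtain a where a: "a \<in> gen {p 0, p 1, p 2}" "c \<circ> p i \<circ> inv_fun c = a \<circ> p 1 \<circ> inv_fun a \<circ> inv_fun (p 1)"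
    using compressed by blast
  have "autJ a" "spread C a \<in> N" using spread_gen[OF normalH_subgrp[OF N] C a(1)] by auto
  then have "spread (C \<inter> D) (c \<circ> p i \<circ> inv_fun c) \<in> N"
    using normalH_commutator[OF N _ D] a(2) spread_commutator[OF _ p_autJ] by metis
  then show "spread (C \<inter> D) (p i) \<in> N" by (rule spreads_in_contract[OF N])
qed

lemma spreads_in_Int': "normalH N \<Longrightarrow> spreads_in N C \<Longrightarrow> spreads_in H D \<Longrightarrow> spreads_in N (C \<inter> D)"
  by (rule spreads_in_Int) (auto simp: spreads_in_def)

lemma spreads_in_H_UNIV: "spreads_in H UNIV" and spreads_in_H_W: "spreads_in H W"
proof -
  have "spread C ` {p 0, p 1, p 2} \<subseteq> H" if "C = UNIV \<or> C = W" for C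
    unfolding H_def using that by (auto simp: S_def intro: gen_base)
  then have "spreads_in H (C \<inter> C)" if "C = UNIV \<or> C = W" for C using that
    by (intro spreads_in_Int[OF normalH_H]) auto
  from this[of UNIV] this[of W] show "spreads_in H UNIV" "spreads_in H W" by auto
qed

lemma spreads_in_H_Compl: "spreads_in H C \<Longrightarrow> spreads_in H (- C)"
  using spreads_in_H_UNIV subgrpD(3,4)[OF H_subgrp] by (simp add: spreads_in_def spread_Compl p_autJ)

lemma spreads_in_Un: "normalH N \<Longrightarrow> spreads_in N C \<Longrightarrow> spreads_in N D \<Longrightarrow> spreads_in H C \<Longrightarrow> spreads_in N (C \<union> D)"
  using spreads_in_Int'[of N D "- C"] spreads_in_H_Compl[of C] subgrpD(3)[OF normalH_subgrp]
  by (simp add: spreads_in_def spread_Un p_autJ)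

lemma spreads_in_translate:
  assumes N: "normalH N" and C: "spreads_in N C"
  shows "spreads_in N ((\<lambda>m. m + d) ` C)"
proof (induction d rule: int_induct[where k=0])
  case base
  then show ?case using C by simp
next
  case (step1 d)
  have "(\<lambda>m. m + (d + 1)) ` C = (\<lambda>m. m + 1) ` ((\<lambda>m. m + d) ` C)" by (auto simp: image_image ac_simps)
  then show ?case
    using step1 normalH_conj[OF N subsetD[OF circle_group_H shift_circ]] by (simp add: spreads_in_def flip: shift_spread)
next
  case (step2 d)
  have "(\<lambda>m. m + d) ` C = (\<lambda>m. m + 1) ` ((\<lambda>m. m + (d - 1)) ` C)" by (auto simp: image_image)
  then show ?case
    using step2 normalH_unconj[OF N subsetD[OF circle_group_H shift_circ]] by (simp add: spreads_in_def flip: shift_spread)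
qed

lemma spreads_in_H_pattern: "finite F \<Longrightarrow> spreads_in H (pattern F)"
proof (induction F rule: finite_induct)
  case empty
  have "pattern {} = UNIV" by (simp add: pattern_def)
  then show ?case using spreads_in_H_UNIV by simp
next
  case (insert j F)
  let ?C = "(\<lambda>m. m + (- j)) ` W"
  have "d \<in> ?C \<longleftrightarrow> j + d \<in> W" for d by (auto intro: image_eqI[where x="j + d"])
  then have "pattern (insert j F) = pattern F \<inter> (if j \<in> W then ?C else - ?C)"
    by (auto simp: pattern_def)
  moreover have "spreads_in H ?C" by (rule spreads_in_translate[OF normalH_H spreads_in_H_W])
  ultimately show ?case using spreads_in_Int'[OF normalH_H insert.IH] spreads_in_H_Compl by auto
qed

text \<open>The elements of \<open>H\<close> are locally determined: their effect at a point depends only on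
  finitely many marks nearby. Compositions and inverses inherit this property from the generators.\<close>

lemma H_local:
  assumes "f \<in> H"
  obtains F where "finite F" "\<And>d. d \<in> pattern F \<Longrightarrow> f (x + of_int d) = f x + of_int d"
proof -
  define L where "L f x F \<longleftrightarrow> finite F \<and> (\<forall>d\<in>pattern F. f (x + of_int d) = f x + of_int d)" for f :: "rat \<Rightarrow> rat" and x and F
  have "subgrp {f. aut f \<and> (\<forall>x. \<exists>F. L f x F)}" (is "subgrp ?K")
    unfolding subgrp_def
  proof (intro conjI ballI)
    fix f g assume "f \<in> ?K" "g \<in> ?K"
    then have a: "aut f" "aut g" and L: "\<exists>F. L f x F" "\<exists>F. L g x F" for x by auto
    have "\<exists>F. L (f \<circ> g) x F" for x
    proof -
      obtain F1 F2 where F: "L g x F1" "L f (g x) F2" using L by blast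
      have "d \<in> pattern F1" "d \<in> pattern F2" if "d \<in> pattern (F1 \<union> F2)" for d
        using that by (auto simp: pattern_def)
      then have "L (f \<circ> g) x (F1 \<union> F2)" using F by (simp add: L_def)
      then show ?thesis ..
    qed
    then show "f \<circ> g \<in> ?K" using a by simp
  next
    fix f assume "f \<in> ?K"
    then have a: "aut f" and L: "\<exists>F. L f x F" for x by auto
    have "\<exists>F. L (inv_fun f) x F" for x
    proof -
      obtain F where "L f (inv_fun f x) F" using L by blast
      then have "L (inv_fun f) x F" using a by (auto simp: L_def aut_inv_eq_iff)
      then show ?thesis ..
    qed
    then show "inv_fun f \<in> ?K" using a by simp
  qed (auto simp: L_def)
  moreover have "S \<subseteq> ?K"
  proof
    fix f assume f: "f \<in> S"
    have "\<exists>F. L f x F" for x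
    proof (cases "f \<in> spread W ` {p 0, p 1, p 2}")
      case True
      then obtain q where q: "f = spread W q" by blast
      have "L f x {\<lfloor>x\<rfloor>}" by (auto simp: L_def q spread_def pattern_def frac_def)
      then show ?thesis ..
    next
      case False
      then have "f (x + of_int d) = f x + of_int d" for d
        using f periodic_int[OF periodic_spread_UNIV] by (auto simp: S_def rot_def)
      then have "L f x {}" by (simp add: L_def)
      then show ?thesis ..
    qed
    then show "f \<in> ?K" using S_aut f by simp
  qed
  ultimately have "H \<subseteq> ?K" unfolding H_def by (rule gen_le)
  then have "\<exists>F. L f x F" using assms by blast
  then show ?thesis using that unfolding L_def by blast
qed

text \<open>The classical commutator trick. The commutator of \<open>n\<close> with the inverse of \<open>f\<close> is \<open>f\<close>
  times a factor that lives outside \<open>U\<close>, and this factor is invisible to \<open>g\<close>.\<close>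

lemma normalH_displaced_commutator:
  assumes N: "normalH N" and n: "n \<in> N" and f: "f \<in> H" "\<And>x. x \<notin> U \<Longrightarrow> f x = x"
    and g: "g \<in> H" "\<And>x. x \<notin> U \<Longrightarrow> g x = x" and U: "\<And>x. x \<in> U \<Longrightarrow> n x \<notin> U"
  shows "f \<circ> g \<circ> inv_fun f \<circ> inv_fun g \<in> N"
proof -
  have nH: "n \<in> H" using N n by (auto simp: normalH_def)
  note aH = subgrpD(1)[OF H_subgrp]
  define A where "A = n \<circ> inv_fun f \<circ> inv_fun n"
  have AH: "A \<in> H" unfolding A_def using nH f subgrpD(3,4)[OF H_subgrp] by blast
  have Afix: "A x = x" if "x \<in> U" for x
  proof -
    have "inv_fun n x \<notin> U" using U[of "inv_fun n x"] aH[OF nH] that by auto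
    then have "inv_fun f (inv_fun n x) = inv_fun n x" using f aH by (simp add: aut_inv_eq_iff)
    then show ?thesis using aH[OF nH] by (simp add: A_def)
  qed
  have fA: "f (A x) = A (f x)" for x
    using disjoint_supports_commute[OF aH[OF f(1)] aH[OF AH] f(2) Afix] .
  have gA: "g (A x) = A (g x)" for x
    using disjoint_supports_commute[OF aH[OF g(1)] aH[OF AH] g(2) Afix] .
  have "n \<circ> inv_fun f \<circ> inv_fun n \<circ> inv_fun (inv_fun f) \<in> N"
    using normalH_commutator[OF N n subgrpD(4)[OF H_subgrp f(1)]] .
  then have AfN: "A \<circ> f \<in> N" using aH[OF f(1)] by (simp add: A_def comp_assoc)
  have "A \<circ> f \<circ> g \<circ> inv_fun (A \<circ> f) \<circ> inv_fun g \<in> N" by (rule normalH_commutator[OF N AfN g(1)])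
  moreover have "A \<circ> f \<circ> g \<circ> inv_fun (A \<circ> f) \<circ> inv_fun g = f \<circ> g \<circ> inv_fun f \<circ> inv_fun g"
  proof
    fix x
    have a: "aut A" "aut f" "aut g" using aH AH f g by auto
    have "inv_fun f (inv_fun A y) = inv_fun A (inv_fun f y)" for y
      using a by (simp add: aut_inv_eq_iff fA[symmetric])
    moreover have "f (inv_fun A y) = inv_fun A (f y)" "g (inv_fun A y) = inv_fun A (g y)" for y
      using fA[of "inv_fun A y"] gA[of "inv_fun A y"] a by (metis aut_inv1 aut_inv2)+
    ultimately show "(A \<circ> f \<circ> g \<circ> inv_fun (A \<circ> f) \<circ> inv_fun g) x = (f \<circ> g \<circ> inv_fun f \<circ> inv_fun g) x"
      using a by (simp add: inv_comp_aut)
  qed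
  ultimately show ?thesis by simp
qed

text \<open>A nontrivial \<open>n\<close> moves some small interval \<open>(u, v)\<close> off itself. As \<open>n\<close> is locally
  determined, it does the same near all translates of this interval by elements of a suitable pattern set.
  By aperiodicity the window can be chosen so large that the images also avoid the other translates.
  The commutator trick then applies to the union of all these translates, into which an element of the
  circle group conjugates the automorphisms spread over the pattern set.\<close>

lemma nontrivial_normalH_spreads:
  assumes N: "normalH N" and "N \<noteq> {id}"
  obtains F where "finite F" "spreads_in N (pattern F)"
proof -
  note aH = subgrpD(1)[OF H_subgrp]
  obtain n0 x0 where n0: "n0 \<in> N" "n0 x0 \<noteq> x0"
    using assms(2) subgrpD(2)[OF normalH_subgrp[OF N]] by fastforce
  have "\<exists>n\<in>N. \<exists>u. u < n u"
  proof (cases "x0 < n0 x0")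
    case False
    then have "n0 x0 < inv_fun n0 (n0 x0)" using n0 N aH by (auto simp: normalH_def)
    then show ?thesis using subgrpD(4)[OF normalH_subgrp[OF N] n0(1)] by blast
  qed (use n0 in blast)
  then obtain n u where n: "n \<in> N" "u < n u" by blast
  have nH: "n \<in> H" using N n by (auto simp: normalH_def)
  \<comment> \<open>The two endpoints control the whole interval, because \<open>n\<close> is monotone.\<close>
  define v where "v = n u"
  have "u < v" using n v_def by simp
  obtain Fu where Fu: "finite Fu" "\<And>d. d \<in> pattern Fu \<Longrightarrow> n (u + of_int d) = n u + of_int d"
    using H_local[OF nH, of u] by blast
  obtain Fv where Fv: "finite Fv" "\<And>d. d \<in> pattern Fv \<Longrightarrow> n (v + of_int d) = n v + of_int d"
    using H_local[OF nH, of v] by blast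
  \<comment> \<open>A translate of the interval meets the image only if the translation is bounded by \<open>B\<close>. For each of
    these finitely many translations, the window includes a place where the marking is not preserved.\<close>
  define B where "B = \<lceil>\<bar>n v - u\<bar>\<rceil>"
  define \<Delta> where "\<Delta> = {- B..B} - {0}"
  obtain j where j: "\<And>d. d \<noteq> 0 \<Longrightarrow> (j d \<in> W) \<noteq> (j d + d \<in> W)"
    using W_aperiodic by metis
  define F where "F = Fu \<union> Fv \<union> (\<Union>d\<in>\<Delta>. {j d, j d + d})"
  have F: "finite F" unfolding F_def \<Delta>_def using Fu Fv by auto
  have FuF: "pattern F \<subseteq> pattern Fu" and FvF: "pattern F \<subseteq> pattern Fv"
    by (intro pattern_mono; auto simp: F_def)+
  have sep: "d' - d \<notin> \<Delta>" if "d \<in> pattern F" "d' \<in> pattern F" for d d'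
  proof
    assume D: "d' - d \<in> \<Delta>"
    let ?j = "j (d' - d)"
    have "?j \<in> F" "?j + (d' - d) \<in> F" using D by (auto simp: F_def)
    then have "?j \<in> W \<longleftrightarrow> ?j + d' \<in> W" "?j + (d' - d) \<in> W \<longleftrightarrow> ?j + (d' - d) + d \<in> W"
      using that unfolding pattern_def by blast+
    moreover have "?j + (d' - d) + d = ?j + d'" by simp
    ultimately have "?j \<in> W \<longleftrightarrow> ?j + (d' - d) \<in> W" by metis
    then show False using j[of "d' - d"] D by (simp add: \<Delta>_def)
  qed
  define U where "U = {z + of_int d |z d. u < z \<and> z < v \<and> d \<in> pattern F}"
  have U: "n y \<notin> U" if yU: "y \<in> U" for y
  proof
    assume "n y \<in> U"
    then obtain z' d' where z': "n y = z' + of_int d'" "u < z'" "z' < v" "d' \<in> pattern F" by (auto simp: U_def)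
    obtain z d where z: "y = z + of_int d" "u < z" "z < v" "d \<in> pattern F" using yU by (auto simp: U_def)
    have "n (u + of_int d) < n y" "n y < n (v + of_int d)" using z aut_less[OF aH[OF nH]] by simp_all
    then have b: "v + of_int d < z' + of_int d'" "z' + of_int d' < n v + of_int d"
      using Fu(2) Fv(2) z(4) FuF FvF z' v_def by auto
    have "of_int (d' - d) > (0::rat)" "of_int (d' - d) < n v - u" using b z' by simp_all
    moreover have "n v - u \<le> of_int B" unfolding B_def by linarith
    ultimately have "of_int (d' - d) < (of_int B :: rat)" "0 < d' - d" by linarith+
    then have "d' - d \<in> \<Delta>" unfolding of_int_less_iff by (auto simp: \<Delta>_def)
    then show False using sep z z' by blast
  qed
  obtain q where q: "q \<in> circle_group" "\<And>x. x \<in> J \<Longrightarrow> u < q x \<and> q x < v"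
    using J_into_interval[OF \<open>u < v\<close>] by blast
  let ?C = "pattern F"
  have qH: "q \<in> H" using q circle_group_H by blast
  define K where "K a = q \<circ> spread ?C a \<circ> inv_fun q" for a
  have K_off: "K a y = y" if "autJ a" "y \<notin> U" for a y
  proof -
    let ?x = "inv_fun q y"
    have y: "y = q (frac ?x) + of_int \<lfloor>?x\<rfloor>"
      using periodic_int[OF circle_group_periodic[OF q(1)], of "frac ?x" "\<lfloor>?x\<rfloor>"] circle_group_aut[OF q(1)] by (simp add: frac_def)
    have "\<not> (\<lfloor>?x\<rfloor> \<in> ?C \<and> frac ?x \<in> J)" using that(2) y q(2) unfolding U_def by blast
    then have "spread ?C a ?x = ?x" using that(1) by (auto simp: spread_def autJ_def frac_def)
    then show ?thesis using circle_group_aut[OF q(1)] by (simp add: K_def)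
  qed
  have sH: "spread ?C ` {p 0, p 1, p 2} \<subseteq> H" using spreads_in_H_pattern[OF F] by (auto simp: spreads_in_def)
  have KH: "K a \<in> H" if "spread ?C a \<in> H" for a
    unfolding K_def by (rule subgrp_conj[OF H_subgrp qH that])
  have "spread ?C (p i) \<in> N" for i
  proof -
    obtain a where a: "a \<in> gen {p 0, p 1, p 2}" "c \<circ> p i \<circ> inv_fun c = a \<circ> p 1 \<circ> inv_fun a \<circ> inv_fun (p 1)"
      using compressed by blast
    have aa: "autJ a" "spread ?C a \<in> H" using spread_gen[OF H_subgrp sH a(1)] by auto
    have p1: "spread ?C (p 1) \<in> H" using sH by simp
    have "K a \<circ> K (p 1) \<circ> inv_fun (K a) \<circ> inv_fun (K (p 1)) \<in> N"
      by (rule normalH_displaced_commutator[OF N n(1) KH[OF aa(2)] K_off[OF aa(1)] KH[OF p1] K_off[OF p_autJ] U])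
    moreover have "K a \<circ> K (p 1) \<circ> inv_fun (K a) \<circ> inv_fun (K (p 1))
      = q \<circ> (spread ?C a \<circ> spread ?C (p 1) \<circ> inv_fun (spread ?C a) \<circ> inv_fun (spread ?C (p 1))) \<circ> inv_fun q"
      unfolding K_def using circle_group_aut[OF q(1)] aH[OF aa(2)] aH[OF p1] by (intro ext) (simp add: inv_comp_aut)
    ultimately have "spread ?C a \<circ> spread ?C (p 1) \<circ> inv_fun (spread ?C a) \<circ> inv_fun (spread ?C (p 1)) \<in> N"
      using normalH_unconj[OF N qH] by simp
    then have "spread ?C (c \<circ> p i \<circ> inv_fun c) \<in> N"
      using spread_commutator[OF aa(1) p_autJ, of ?C ?C 1] a(2) by simp
    then show ?thesis by (rule spreads_in_contract[OF N])
  qed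
  then have "spreads_in N ?C" by (simp add: spreads_in_def)
  then show ?thesis using that F by blast
qed

text \<open>The pattern set supplied by the preceding lemma contains a residue class, so finitely
  many of its translates cover all cells. Hence \<open>N\<close> contains everything spread over all cells, then
  also everything spread over the marked cells, and finally the rotation.\<close>

lemma H_simple:
  assumes N: "normalH N" and "N \<noteq> {id}"
  shows "N = H"
proof -
  obtain F where F: "finite F" "spreads_in N (pattern F)" using nontrivial_normalH_spreads[OF assms] .
  obtain a k where k: "0 < k" "\<And>t. a + k * t \<in> pattern F" using pattern_residue_class[OF F(1)] by blast
  let ?T = "\<lambda>d. (\<lambda>m. m + d) ` pattern F"
  have "spreads_in N (\<Union>d\<in>D. ?T d) \<and> spreads_in H (\<Union>d\<in>D. ?T d)" if "finite D" "D \<noteq> {}" for D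
    using that
  proof (induction D rule: finite_ne_induct)
    case (singleton d)
    then show ?case using spreads_in_translate N normalH_H F spreads_in_H_pattern by simp
  next
    case (insert d D)
    have "spreads_in N (?T d)" "spreads_in H (?T d)" using spreads_in_translate N normalH_H F spreads_in_H_pattern by blast+
    then show ?case using spreads_in_Un N normalH_H insert by simp
  qed
  from this[of "{0..<k}"] have "spreads_in N (\<Union>d\<in>{0..<k}. ?T d)" using k by simp
  moreover have "(\<Union>d\<in>{0..<k}. ?T d) = UNIV"
  proof (rule UNIV_eq_I[symmetric], rule UN_I)
    fix m
    show "(m - a) mod k \<in> {0..<k}" using k by simp
    have "m = (a + k * ((m - a) div k)) + (m - a) mod k" by simp
    then show "m \<in> ?T ((m - a) mod k)" using k(2) by blast
  qed
  ultimately have U: "spreads_in N UNIV" by simp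
  then have "spreads_in N W" using spreads_in_Int'[OF N U spreads_in_H_W] by simp
  have sub: "subgrp N" using N normalH_subgrp by blast
  have "h \<circ> spread UNIV (p 3) \<circ> inv_fun h \<in> N"
    using U normalH_conj[OF N] h circle_group_H by (auto simp: spreads_in_def)
  moreover have "spread UNIV bump \<in> N" using U p2 by (metis spreads_in_def)
  ultimately have "rot \<in> N" using h(2) subgrpD(3)[OF sub] by metis
  then have "S \<subseteq> N" using U \<open>spreads_in N W\<close> by (auto simp: S_def spreads_in_def)
  then have "H \<subseteq> N" unfolding H_def by (rule gen_le[OF sub])
  then show ?thesis using N by (auto simp: normalH_def)
qed

end

section \<open>Countable dense linear orders are isomorphic\<close>

text \<open>Nonempty countable dense linear orders without endpoints, on a carrier set.\<close>

definition dlo :: "'a set \<Rightarrow> ('a \<Rightarrow> 'a \<Rightarrow> bool) \<Rightarrow> bool" where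
  "dlo A lt \<longleftrightarrow> countable A \<and> A \<noteq> {} \<and> (\<forall>x\<in>A. \<not> lt x x)
     \<and> (\<forall>x\<in>A. \<forall>y\<in>A. \<forall>z\<in>A. lt x y \<longrightarrow> lt y z \<longrightarrow> lt x z)
     \<and> (\<forall>x\<in>A. \<forall>y\<in>A. x = y \<or> lt x y \<or> lt y x)
     \<and> (\<forall>x\<in>A. \<forall>y\<in>A. lt x y \<longrightarrow> (\<exists>z\<in>A. lt x z \<and> lt z y))
     \<and> (\<forall>x\<in>A. \<exists>y\<in>A. lt x y) \<and> (\<forall>x\<in>A. \<exists>y\<in>A. lt y x)"

lemma dloD:
  assumes "dlo A lt"
  shows "countable A" "A \<noteq> {}" "x \<in> A \<Longrightarrow> \<not> lt x x"
    "x \<in> A \<Longrightarrow> y \<in> A \<Longrightarrow> z \<in> A \<Longrightarrow> lt x y \<Longrightarrow> lt y z \<Longrightarrow> lt x z"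
    "x \<in> A \<Longrightarrow> y \<in> A \<Longrightarrow> x = y \<or> lt x y \<or> lt y x"
    "x \<in> A \<Longrightarrow> y \<in> A \<Longrightarrow> lt x y \<Longrightarrow> \<exists>z\<in>A. lt x z \<and> lt z y"
    "x \<in> A \<Longrightarrow> \<exists>y\<in>A. lt x y" "x \<in> A \<Longrightarrow> \<exists>y\<in>A. lt y x"
  using assms unfolding dlo_def by blast+

lemma dlo_dual: "dlo A lt \<Longrightarrow> dlo A (\<lambda>x y. lt y x)"
  unfolding dlo_def by blast

lemma dlo_finite_max:
  assumes A: "dlo A lt" and "finite L" "L \<noteq> {}" "L \<subseteq> A"
  shows "\<exists>m\<in>L. \<forall>l\<in>L. l = m \<or> lt l m"
  using assms(2-4)
proof (induction L rule: finite_ne_induct)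
  case (insert x L)
  then obtain m where m: "m \<in> L" "\<forall>l\<in>L. l = m \<or> lt l m" by auto
  have mx: "m \<in> A" "x \<in> A" "L \<subseteq> A" using m insert by auto
  show ?case
  proof (cases "lt m x")
    case True
    have "lt l x" if l: "l \<in> L" for l
    proof (cases "l = m")
      case False
      then have "lt l m" using m(2) l by blast
      then show ?thesis using dloD(4)[OF A subsetD[OF mx(3) l] mx(1,2)] True by simp
    qed (use True in simp)
    then show ?thesis by blast
  next
    case False
    then have "x = m \<or> lt x m" using dloD(5)[OF A mx(1,2)] by blast
    then show ?thesis using m by blast
  qed
qed simp

lemma dlo_between:
  assumes A: "dlo A lt" and L: "finite L" "L \<subseteq> A" and U: "finite U" "U \<subseteq> A"
    and LU: "\<And>l u. l \<in> L \<Longrightarrow> u \<in> U \<Longrightarrow> lt l u"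
  shows "\<exists>y\<in>A. (\<forall>l\<in>L. lt l y) \<and> (\<forall>u\<in>U. lt y u)"
proof -
  have max: "\<exists>m\<in>L. \<forall>y\<in>A. lt m y \<longrightarrow> (\<forall>l\<in>L. lt l y)" if ne: "L \<noteq> {}"
  proof -
    obtain m where m: "m \<in> L" "\<forall>l\<in>L. l = m \<or> lt l m" using dlo_finite_max[OF A L(1) ne L(2)] by blast
    have "lt l y" if "y \<in> A" "lt m y" "l \<in> L" for y l
      using m(2) that dloD(4)[OF A subsetD[OF L(2) that(3)] subsetD[OF L(2) m(1)] that(1)] by (cases "l = m") auto
    then show ?thesis using m(1) by blast
  qed
  have min: "\<exists>m\<in>U. \<forall>y\<in>A. lt y m \<longrightarrow> (\<forall>u\<in>U. lt y u)" if ne: "U \<noteq> {}"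
  proof -
    obtain m where m: "m \<in> U" "\<forall>l\<in>U. l = m \<or> lt m l"
      using dlo_finite_max[OF dlo_dual[OF A] U(1) ne U(2)] by blast
    have "lt y u" if "y \<in> A" "lt y m" "u \<in> U" for y u
      using m(2) that dloD(4)[OF A that(1) subsetD[OF U(2) m(1)] subsetD[OF U(2) that(3)]] by (cases "u = m") auto
    then show ?thesis using m(1) by blast
  qed
  show ?thesis
  proof (cases "L = {}"; cases "U = {}")
    assume "L = {}" "U = {}"
    then show ?thesis using dloD(2)[OF A] by auto
  next
    assume *: "L = {}" "U \<noteq> {}"
    then obtain m where "m \<in> U" "\<forall>y\<in>A. lt y m \<longrightarrow> (\<forall>u\<in>U. lt y u)" using min by blast
    moreover have "m \<in> A" using U calculation by blast
    ultimately show ?thesis using dloD(8)[OF A \<open>m \<in> A\<close>] * by blast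
  next
    assume *: "L \<noteq> {}" "U = {}"
    then obtain m where "m \<in> L" "\<forall>y\<in>A. lt m y \<longrightarrow> (\<forall>l\<in>L. lt l y)" using max by blast
    moreover have "m \<in> A" using L calculation by blast
    ultimately show ?thesis using dloD(7)[OF A \<open>m \<in> A\<close>] * by blast
  next
    assume *: "L \<noteq> {}" "U \<noteq> {}"
    obtain m where m: "m \<in> L" "\<forall>y\<in>A. lt m y \<longrightarrow> (\<forall>l\<in>L. lt l y)" using max * by blast
    obtain m' where m': "m' \<in> U" "\<forall>y\<in>A. lt y m' \<longrightarrow> (\<forall>u\<in>U. lt y u)" using min * by blast
    have mA: "m \<in> A" "m' \<in> A" using m m' L U by auto
    obtain z where z: "z \<in> A" "lt m z" "lt z m'" using dloD(6)[OF A mA LU[OF m(1) m'(1)]] by blast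
    then show ?thesis using m(2) m'(2) by (intro bexI[OF _ z(1)]) simp
  qed
qed

definition finite_iso :: "'a set \<Rightarrow> ('a \<Rightarrow> 'a \<Rightarrow> bool) \<Rightarrow> 'b set \<Rightarrow> ('b \<Rightarrow> 'b \<Rightarrow> bool) \<Rightarrow> ('a \<times> 'b) set \<Rightarrow> bool" where
  "finite_iso A lt B lt' h \<longleftrightarrow> finite h \<and> h \<subseteq> A \<times> B
     \<and> (\<forall>x y x' y'. (x, y) \<in> h \<longrightarrow> (x', y') \<in> h \<longrightarrow> (lt x x' \<longleftrightarrow> lt' y y') \<and> (x = x' \<longleftrightarrow> y = y'))"

lemma finite_iso_converse: "finite_iso A lt B lt' h \<Longrightarrow> finite_iso B lt' A lt (h\<inverse>)"
  unfolding finite_iso_def by auto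

lemma finite_iso_forth:
  assumes A: "dlo A lt" and B: "dlo B lt'" and h: "finite_iso A lt B lt' h" and x: "x \<in> A"
  shows "\<exists>h'. finite_iso A lt B lt' h' \<and> h \<subseteq> h' \<and> x \<in> Domain h'"
proof (cases "x \<in> Domain h")
  case False
  define L where "L = {y. \<exists>x'. (x', y) \<in> h \<and> lt x' x}"
  define U where "U = {y. \<exists>x'. (x', y) \<in> h \<and> lt x x'}"
  have h2: "finite h" "h \<subseteq> A \<times> B"
    "\<And>x y x' y'. (x, y) \<in> h \<Longrightarrow> (x', y') \<in> h \<Longrightarrow> (lt x x' \<longleftrightarrow> lt' y y') \<and> (x = x' \<longleftrightarrow> y = y')"
    using h unfolding finite_iso_def by blast+
  have "L \<subseteq> snd ` h" "U \<subseteq> snd ` h" unfolding L_def U_def by force+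
  then have LU: "finite L" "finite U" using h2(1) by (auto intro: finite_subset)
  have LUB: "L \<subseteq> B" "U \<subseteq> B" using h2(2) unfolding L_def U_def by blast+
  have "lt' l u" if lu: "l \<in> L" "u \<in> U" for l u
  proof -
    obtain a b where ab: "(a, l) \<in> h" "lt a x" "(b, u) \<in> h" "lt x b" using lu unfolding L_def U_def by blast
    have "lt a b" using dloD(4)[OF A _ x _ ab(2,4)] ab h2(2) by blast
    then show ?thesis using h2(3)[OF ab(1,3)] by blast
  qed
  then obtain y where y: "y \<in> B" "\<forall>l\<in>L. lt' l y" "\<forall>u\<in>U. lt' y u"
    using dlo_between[OF B LU(1) LUB(1) LU(2) LUB(2)] by blast
  have new: "(lt a x \<longleftrightarrow> lt' b y) \<and> (lt x a \<longleftrightarrow> lt' y b) \<and> a \<noteq> x \<and> b \<noteq> y" if ab: "(a, b) \<in> h" for a b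
  proof -
    have aA: "a \<in> A" "b \<in> B" using ab h2(2) by auto
    have "a \<noteq> x" using ab False by auto
    have Byy: "\<not> lt' b b" "\<not> lt' y y" "\<not> (lt' b y \<and> lt' y b)"
      using dloD(3)[OF B] dloD(4)[OF B aA(2) y(1) aA(2)] aA y(1) by blast+
    have Axx: "\<not> (lt a x \<and> lt x a)" using dloD(3)[OF A] dloD(4)[OF A aA(1) x aA(1)] aA by blast
    consider "lt a x" | "lt x a" using dloD(5)[OF A aA(1) x] \<open>a \<noteq> x\<close> by blast
    then show ?thesis
    proof cases
      case 1
      then have "lt' b y" using y(2) ab unfolding L_def by blast
      then show ?thesis using 1 Byy Axx \<open>a \<noteq> x\<close> by blast
    next
      case 2
      then have "lt' y b" using y(3) ab unfolding U_def by blast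
      then show ?thesis using 2 Byy Axx \<open>a \<noteq> x\<close> by blast
    qed
  qed
  have "finite_iso A lt B lt' (insert (x, y) h)"
    unfolding finite_iso_def
  proof (intro conjI allI impI)
    fix a b a' b' assume *: "(a, b) \<in> insert (x, y) h" "(a', b') \<in> insert (x, y) h"
    show "lt a a' \<longleftrightarrow> lt' b b'"
      using * h2(3) new dloD(3)[OF A x] dloD(3)[OF B y(1)] by blast
    show "a = a' \<longleftrightarrow> b = b'" using * h2(3) new by blast
  qed (use h2 x y in auto)
  then show ?thesis by (intro exI[of _ "insert (x, y) h"]) auto
qed (use h in blast)

text \<open>The theorem of Cantor, proved by going back and forth.\<close>

lemma dlo_isomorphic:
  assumes A: "dlo A lt" and B: "dlo B lt'"
  obtains f where "bij_betw f A B" "\<And>x y. x \<in> A \<Longrightarrow> y \<in> A \<Longrightarrow> lt x y \<longleftrightarrow> lt' (f x) (f y)"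
proof -
  let ?a = "from_nat_into A" and ?b = "from_nat_into B"
  have "\<exists>h. \<forall>n::nat. finite_iso A lt B lt' (h n) \<and> (h n \<subseteq> h (Suc n) \<and> ?a n \<in> Domain (h (Suc n)) \<and> ?b n \<in> Range (h (Suc n)))"
  proof (rule dependent_nat_choice)
    show "\<exists>h. finite_iso A lt B lt' h" by (rule exI[of _ "{}"]) (simp add: finite_iso_def)
    fix h and n :: nat assume h: "finite_iso A lt B lt' h"
    obtain h1 where h1: "finite_iso A lt B lt' h1" "h \<subseteq> h1" "?a n \<in> Domain h1"
      using finite_iso_forth[OF A B h from_nat_into[OF dloD(2)[OF A]]] by blast
    obtain h2 where h2: "finite_iso B lt' A lt h2" "h1\<inverse> \<subseteq> h2" "?b n \<in> Domain h2"
      using finite_iso_forth[OF B A finite_iso_converse[OF h1(1)] from_nat_into[OF dloD(2)[OF B]]] by blast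
    have "finite_iso A lt B lt' (h2\<inverse>)" "h \<subseteq> h2\<inverse>" "?a n \<in> Domain (h2\<inverse>)" "?b n \<in> Range (h2\<inverse>)"
      using finite_iso_converse[OF h2(1)] h1 h2 by auto
    then show "\<exists>h'. finite_iso A lt B lt' h' \<and> h \<subseteq> h' \<and> ?a n \<in> Domain h' \<and> ?b n \<in> Range h'" by blast
  qed
  then obtain h where h: "\<And>n. finite_iso A lt B lt' (h n)" "\<And>n. h n \<subseteq> h (Suc n)"
    "\<And>n. ?a n \<in> Domain (h (Suc n))" "\<And>n. ?b n \<in> Range (h (Suc n))" by blast
  have mono: "h n \<subseteq> h m" if "n \<le> m" for n m using lift_Suc_mono_le[of h, OF h(2) that] .
  define R where "R = (\<Union>n. h n)"
  have R: "(lt x x' \<longleftrightarrow> lt' y y') \<and> (x = x' \<longleftrightarrow> y = y')" if xy: "(x, y) \<in> R" "(x', y') \<in> R" for x y x' y'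
  proof -
    obtain n m where "(x, y) \<in> h n" "(x', y') \<in> h m" using xy unfolding R_def by blast
    then have "(x, y) \<in> h (max n m)" "(x', y') \<in> h (max n m)"
      using mono[of n "max n m"] mono[of m "max n m"] by auto
    then show ?thesis using h(1)[of "max n m"] unfolding finite_iso_def by blast
  qed
  have RA: "\<exists>y. (x, y) \<in> R" if xA: "x \<in> A" for x
  proof -
    obtain n where "x = ?a n" using from_nat_into_surj[OF dloD(1)[OF A] xA] by metis
    then show ?thesis using h(3)[of n] unfolding R_def by auto
  qed
  have RB: "\<exists>x. (x, y) \<in> R" if yB: "y \<in> B" for y
  proof -
    obtain n where "y = ?b n" using from_nat_into_surj[OF dloD(1)[OF B] yB] by metis
    then show ?thesis using h(4)[of n] unfolding R_def by auto
  qed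
  have sub: "R \<subseteq> A \<times> B" using h(1) unfolding R_def finite_iso_def by blast
  define f where "f x = (SOME y. (x, y) \<in> R)" for x
  have f: "(x, f x) \<in> R" if "x \<in> A" for x unfolding f_def using someI_ex[OF RA[OF that]] .
  show ?thesis
  proof (rule that)
    show "bij_betw f A B"
      unfolding bij_betw_def
    proof (intro conjI inj_onI equalityI subsetI)
      show "x = y" if "x \<in> A" "y \<in> A" "f x = f y" for x y using R[OF f f] that by blast
    next
      fix y assume "y \<in> f ` A"
      then show "y \<in> B" using f sub by blast
    next
      fix y assume "y \<in> B"
      then obtain x where x: "(x, y) \<in> R" using RB by blast
      then have "x \<in> A" using sub by blast
      then show "y \<in> f ` A" using R[OF x f[OF \<open>x \<in> A\<close>]] by blast
    qed
    show "lt x y \<longleftrightarrow> lt' (f x) (f y)" if "x \<in> A" "y \<in> A" for x y using R[OF f f] that by blast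
  qed
qed

section \<open>Left-ordered groups act on the half cell\<close>

lemma dlo_J: "dlo J (<)"
  unfolding dlo_def
proof (intro conjI ballI impI)
  show "J \<noteq> {}" by (auto simp: J_def intro!: exI[of _ "1/4"])
  fix x assume x: "x \<in> J"
  show "\<exists>y\<in>J. x < y" using x by (intro bexI[of _ "(x + 1/2) / 2"]) (auto simp: J_def)
  show "\<exists>y\<in>J. y < x" using x by (intro bexI[of _ "x / 2"]) (auto simp: J_def)
  fix y assume y: "y \<in> J" "x < y"
  then show "\<exists>z\<in>J. x < z \<and> z < y" using x by (intro bexI[of _ "(x + y) / 2"]) (auto simp: J_def)
qed (auto simp: J_def)

lemma left_ordered_mult_iff:
  fixes G :: "('a, 'b) monoid_scheme" (structure)
  assumes G: "left_ordered_group G r" and a: "a \<in> carrier G" "x \<in> carrier G" "y \<in> carrier G"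
  shows "(a \<otimes>\<^bsub>G\<^esub> x, a \<otimes>\<^bsub>G\<^esub> y) \<in> r \<longleftrightarrow> (x, y) \<in> r"
proof
  interpret group G using G by (simp add: left_ordered_group_def)
  have L: "(b \<otimes> u, b \<otimes> v) \<in> r" if "(u, v) \<in> r" "b \<in> carrier G" "u \<in> carrier G" "v \<in> carrier G" for b u v
    using G that unfolding left_ordered_group_def by blast
  show "(x, y) \<in> r \<Longrightarrow> (a \<otimes> x, a \<otimes> y) \<in> r" using L a by blast
  assume "(a \<otimes> x, a \<otimes> y) \<in> r"
  then have "(inv a \<otimes> (a \<otimes> x), inv a \<otimes> (a \<otimes> y)) \<in> r" using L a by simp
  then show "(x, y) \<in> r" using a by (simp flip: m_assoc)
qed

text \<open>Each point of the group is blown up to a copy of the rationals. The lexicographic order so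
  obtained is isomorphic to the half cell, and left multiplication acts on the first coordinate. The
  orbit of the point \<open>(\<one>, 0)\<close> is a copy of the ordered group.\<close>

lemma left_ordered_action:
  fixes G :: "('a, 'b) monoid_scheme" (structure)
  assumes G: "left_ordered_group G r" and count: "countable (carrier G)"
  obtains act x0 where "x0 \<in> J" "\<forall>g\<in>carrier G. autJ (act g)"
    "\<forall>g\<in>carrier G. \<forall>h\<in>carrier G. act (g \<otimes> h) = act g \<circ> act h"
    "\<forall>g\<in>carrier G. \<forall>h\<in>carrier G. (g, h) \<in> r \<longleftrightarrow> act g x0 \<le> act h x0"
proof -
  interpret group G using G by (simp add: left_ordered_group_def)
  have lin: "linear_order_on (carrier G) r" using G by (simp add: left_ordered_group_def)
  have ord: "refl_on (carrier G) r" "trans r" "antisym r" "total_on (carrier G) r"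
    using lin by (simp_all add: linear_order_on_def partial_order_on_def preorder_on_def)
  have r3: "(x, x) \<in> r" if "x \<in> carrier G" for x using ord(1) that by (rule refl_onD)
  have r4: "(x, y) \<in> r \<or> (y, x) \<in> r" if "x \<in> carrier G" "y \<in> carrier G" for x y
    using ord(4) r3[OF that(1)] that by (cases "x = y") (auto simp: total_on_def)
  have rt: "(x, z) \<in> r" if "(x, y) \<in> r" "(y, z) \<in> r" for x y z using ord(2) that by (rule transD)
  have ra: "x = y" if "(x, y) \<in> r" "(y, x) \<in> r" for x y using ord(3) that by (rule antisymD)
  define A where "A = carrier G \<times> (UNIV :: rat set)"
  define lt where "lt u v \<longleftrightarrow> ((fst u, fst v) \<in> r \<and> fst u \<noteq> fst v) \<or> (fst u = fst v \<and> snd u < (snd v :: rat))"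
    for u v :: "'a \<times> rat"
  have "dlo A lt"
    unfolding dlo_def
  proof (intro conjI ballI impI)
    show "countable A" unfolding A_def using count by simp
    show "A \<noteq> {}" unfolding A_def by auto
    fix u assume u: "u \<in> A"
    show "\<not> lt u u" by (simp add: lt_def)
    show "\<exists>v\<in>A. lt u v" using u by (intro bexI[of _ "(fst u, snd u + 1)"]) (auto simp: lt_def A_def)
    show "\<exists>v\<in>A. lt v u" using u by (intro bexI[of _ "(fst u, snd u - 1)"]) (auto simp: lt_def A_def)
    fix v assume v: "v \<in> A"
    show "u = v \<or> lt u v \<or> lt v u" using u v r4[of "fst u" "fst v"] by (auto simp: lt_def A_def prod_eq_iff)
    show "\<exists>w\<in>A. lt u w \<and> lt w v" if "lt u v"
    proof (cases "fst u = fst v")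
      case True
      then show ?thesis using that u
        by (intro bexI[of _ "(fst u, (snd u + snd v) / 2)"]) (auto simp: lt_def A_def)
    next
      case False
      then show ?thesis using that u
        by (intro bexI[of _ "(fst u, snd u + 1)"]) (auto simp: lt_def A_def)
    qed
    fix w assume "w \<in> A" "lt u v" "lt v w"
    then show "lt u w" using rt[of "fst u" "fst v" "fst w"] ra[of "fst u" "fst v"] by (auto simp: lt_def)
  qed
  then obtain f where f: "bij_betw f A J" "\<And>x y. x \<in> A \<Longrightarrow> y \<in> A \<Longrightarrow> lt x y \<longleftrightarrow> f x < f y"
    using dlo_isomorphic[OF _ dlo_J] by blast
  define f' where "f' = inv_into A f"
  have ff': "f' x \<in> A" "f (f' x) = x" if "x \<in> J" for x
    using f(1) that unfolding f'_def bij_betw_def by (auto simp: inv_into_into f_inv_into_f)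
  have f'f: "f' (f u) = u" "f u \<in> J" if "u \<in> A" for u
    using f(1) that unfolding f'_def bij_betw_def by auto
  define mv where "mv g u = (g \<otimes> fst u, snd u)" for g and u :: "'a \<times> rat"
  have mvA: "mv g u \<in> A" if "g \<in> carrier G" "u \<in> A" for g u using that by (auto simp: mv_def A_def)
  have mv_lt: "lt (mv g u) (mv g v) \<longleftrightarrow> lt u v" if "g \<in> carrier G" "u \<in> A" "v \<in> A" for g u v
    using that left_ordered_mult_iff[OF G] by (auto simp: lt_def mv_def A_def)
  define act where "act g x = (if x \<in> J then f (mv g (f' x)) else x)" for g x
  have actJ: "act g x \<in> J" if "g \<in> carrier G" "x \<in> J" for g x
    using that f'f mvA ff' by (simp add: act_def)
  have comp: "act (g \<otimes> h) = act g \<circ> act h" if gh: "g \<in> carrier G" "h \<in> carrier G" for g h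
  proof
    fix x
    show "act (g \<otimes> h) x = (act g \<circ> act h) x"
    proof (cases "x \<in> J")
      case True
      have "fst (f' x) \<in> carrier G" using ff'(1)[OF True] by (auto simp: A_def)
      then have "mv (g \<otimes> h) (f' x) = mv g (mv h (f' x))" using gh by (simp add: mv_def m_assoc)
      then show ?thesis using True actJ[OF gh(2) True] f'f mvA ff' gh by (simp add: act_def)
    qed (simp add: act_def)
  qed
  have one: "act \<one> x = x" for x
  proof (cases "x \<in> J")
    case True
    have "mv \<one> (f' x) = f' x" using ff'(1)[OF True] by (auto simp: mv_def A_def)
    then show ?thesis using True ff' by (simp add: act_def)
  qed (simp add: act_def)
  have autJ: "autJ (act g)" if g: "g \<in> carrier G" for g
  proof -
    have "aut (act g)"
    proof (rule aut_inverseI)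
      show "act g (act (inv g) x) = x" for x
        using comp[of g "inv g"] g one[of x] by (simp add: fun_eq_iff)
      fix x y :: rat assume xy: "x < y"
      show "act g x < act g y"
      proof (cases "x \<in> J \<and> y \<in> J")
        case True
        then have "lt (f' x) (f' y)" using f(2)[of "f' x" "f' y"] ff' xy by simp
        then have "lt (mv g (f' x)) (mv g (f' y))" using mv_lt g ff' True by simp
        then show ?thesis using f(2) mvA g ff' True by (simp add: act_def)
      next
        case False
        have "x \<in> J \<Longrightarrow> act g x \<in> J" "y \<in> J \<Longrightarrow> act g y \<in> J" using actJ g by auto
        moreover have "x \<notin> J \<Longrightarrow> act g x = x" "y \<notin> J \<Longrightarrow> act g y = y" by (auto simp: act_def)
        ultimately show ?thesis using xy False unfolding J_def
          by (cases "x \<in> J"; cases "y \<in> J") (auto simp: J_def)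
      qed
    qed
    then show ?thesis by (simp add: autJ_def act_def)
  qed
  define x0 where "x0 = f (\<one>, 0)"
  have x0: "x0 \<in> J" unfolding x0_def by (rule f'f) (simp add: A_def)
  have act_x0: "act g x0 = f (g, 0)" if "g \<in> carrier G" for g
    using that x0 f'f(1)[of "(\<one>, 0)"] by (simp add: act_def mv_def A_def) (simp add: x0_def)
  have "(g, h) \<in> r \<longleftrightarrow> act g x0 \<le> act h x0" if gh: "g \<in> carrier G" "h \<in> carrier G" for g h
  proof -
    have "act h x0 < act g x0 \<longleftrightarrow> lt (h, 0) (g, 0)"
      using f(2)[of "(h, 0)" "(g, 0)"] gh act_x0 by (simp add: A_def)
    also have "\<dots> \<longleftrightarrow> (g, h) \<notin> r" using r3 r4 ra gh by (auto simp: lt_def)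
    finally show ?thesis by (auto simp: not_less[symmetric])
  qed
  with x0 autJ comp show ?thesis by (intro that[of x0 act]) simp_all
qed

section \<open>Left orders on groups of automorphisms\<close>

definition enum_from :: "rat \<Rightarrow> nat \<Rightarrow> rat" where
  "enum_from x0 n = (case n of 0 \<Rightarrow> x0 | Suc m \<Rightarrow> from_nat m)"

lemma enum_from_surj: "\<exists>n. enum_from x0 n = x"
  by (rule exI[of _ "Suc (to_nat x)"]) (simp add: enum_from_def)

text \<open>Composition from the left with an increasing map does not change the first point of the
  enumeration where two automorphisms differ, nor the direction of the difference there.\<close>

definition aut_order :: "rat \<Rightarrow> (rat \<Rightarrow> rat) set \<Rightarrow> (rat \<Rightarrow> rat) rel" where
  "aut_order x0 K = {(f, g). f \<in> K \<and> g \<in> K \<and> (f = g \<or> less_fun (f \<circ> enum_from x0) (g \<circ> enum_from x0))}"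

lemma less_fun_total:
  fixes u v :: "nat \<Rightarrow> rat"
  assumes "u \<noteq> v"
  shows "less_fun u v \<or> less_fun v u"
proof -
  obtain n where "u n \<noteq> v n" using assms by blast
  define k where "k = (LEAST n. u n \<noteq> v n)"
  have k: "u k \<noteq> v k" "\<forall>k'<k. u k' = v k'"
    unfolding k_def using \<open>u n \<noteq> v n\<close> by (rule LeastI) (use not_less_Least in blast)
  then have "u k < v k \<or> v k < u k" by auto
  then show ?thesis using k(2) unfolding less_fun_def by metis
qed

lemma left_ordered_aut:
  assumes K: "subgrp K"
  shows "left_ordered_group (AutQ\<lparr>carrier := K\<rparr>) (aut_order x0 K)"
proof -
  let ?e = "enum_from x0"
  have eq: "f = g" if "f \<circ> ?e = g \<circ> ?e" for f g
    using that enum_from_surj[of x0] by (metis comp_apply ext)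
  have "linear_order_on K (aut_order x0 K)"
    unfolding linear_order_on_def partial_order_on_def preorder_on_def
  proof (intro conjI)
    show "refl_on K (aut_order x0 K)" by (auto simp: refl_on_def aut_order_def)
    show "trans (aut_order x0 K)"
      by (rule transI) (auto simp: aut_order_def intro: less_fun_trans)
    show "antisym (aut_order x0 K)"
      by (rule antisymI) (auto simp: aut_order_def dest: less_fun_asym)
    show "total_on K (aut_order x0 K)"
    proof (rule total_onI)
      fix f g assume "f \<in> K" "g \<in> K" "f \<noteq> g"
      then show "(f, g) \<in> aut_order x0 K \<or> (g, f) \<in> aut_order x0 K"
        using less_fun_total[of "f \<circ> ?e" "g \<circ> ?e"] eq by (auto simp: aut_order_def)
    qed
  qed (auto simp: aut_order_def)
  moreover have "(h \<circ> f, h \<circ> g) \<in> aut_order x0 K"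
    if "h \<in> K" "f \<in> K" "g \<in> K" "(f, g) \<in> aut_order x0 K" for h f g
    using that subgrpD(3)[OF K] subgrpD(1)[OF K] by (auto simp: aut_order_def less_fun_def aut_less)
  moreover have "group (AutQ\<lparr>carrier := K\<rparr>)"
    using K group.subgroup_imp_group[OF AutQ_group] by (simp add: subgrp_iff_subgroup)
  ultimately show ?thesis by (simp add: left_ordered_group_def)
qed

lemma aut_order_at_base_point:
  assumes "f \<in> K" "g \<in> K" "f x0 \<noteq> g x0"
  shows "(f, g) \<in> aut_order x0 K \<longleftrightarrow> f x0 < g x0"
proof -
  have "less_fun (f \<circ> enum_from x0) (g \<circ> enum_from x0)" if "f x0 < g x0" for f g :: "rat \<Rightarrow> rat"
    unfolding less_fun_def using that by (intro exI[of _ 0]) (simp add: enum_from_def)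
  then show ?thesis using assms less_fun_asym by (fastforce simp: aut_order_def neq_iff)
qed

section \<open>Countable groups as groups of natural numbers\<close>

lemma countable_gen:
  assumes S: "countable S" "\<And>f. f \<in> S \<Longrightarrow> aut f"
  shows "countable (gen S)"
proof -
  let ?T = "S \<union> inv_fun ` S"
  have "gen S \<subseteq> (\<lambda>w. foldr (\<circ>) w id) ` lists ?T"
  proof
    fix f assume "f \<in> gen S"
    then show "f \<in> (\<lambda>w. foldr (\<circ>) w id) ` lists ?T"
    proof (induction rule: generate.induct)
      case one
      show ?case by (rule image_eqI[where x="[]"]) auto
    next
      case (incl f)
      then show ?case by (intro image_eqI[where x="[f]"]) auto
    next
      case (inv f)
      then show ?case using S(2) by (intro image_eqI[where x="[inv_fun f]"]) auto
    next
      case (eng f g)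
      then obtain v w where vw: "v \<in> lists ?T" "w \<in> lists ?T" "f = foldr (\<circ>) v id" "g = foldr (\<circ>) w id" by blast
      have comp: "foldr (\<circ>) v g = foldr (\<circ>) v id \<circ> g" for v :: "(rat \<Rightarrow> rat) list" and g
        by (induction v) (auto simp: comp_assoc)
      have "f \<circ> g = foldr (\<circ>) (v @ w) id"
        unfolding foldr_append vw(3,4) by (rule comp[symmetric])
      moreover have "v @ w \<in> lists ?T" using vw(1,2) by simp
      ultimately show ?case unfolding AutQ_simps by (rule image_eqI)
    qed
  qed
  then show ?thesis using S(1) by (meson countable_Un countable_image countable_lists countable_subset)
qed

lemma transport_to_nat:
  fixes K :: "'c monoid" and G :: "('a, 'b) monoid_scheme"
  assumes K: "left_ordered_group K s" "finitely_generated K" "is_simple K" and count: "countable (carrier K)"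
    and \<phi>: "\<phi> \<in> mon G K" "\<forall>x\<in>carrier G. \<forall>y\<in>carrier G. (x, y) \<in> r \<longleftrightarrow> (\<phi> x, \<phi> y) \<in> s"
  shows "\<exists>(H :: nat monoid) s \<phi>.
           left_ordered_group H s \<and> finitely_generated H \<and> is_simple H \<and>
           \<phi> \<in> mon G H \<and>
           (\<forall>x\<in>carrier G. \<forall>y\<in>carrier G. (x, y) \<in> r \<longleftrightarrow> (\<phi> x, \<phi> y) \<in> s)"
proof -
  interpret K: group K using K(1) by (simp add: left_ordered_group_def)
  let ?C = "carrier K"
  define \<iota> where "\<iota> = to_nat_on ?C"
  define \<kappa> where "\<kappa> = inv_into ?C \<iota>"
  have inj: "inj_on \<iota> ?C" unfolding \<iota>_def using count by (rule inj_on_to_nat_on)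
  have \<kappa>\<iota>: "\<kappa> (\<iota> x) = x" if "x \<in> ?C" for x unfolding \<kappa>_def using inj that by simp
  define M :: "nat monoid" where
    "M = \<lparr>carrier = \<iota> ` ?C, monoid.mult = (\<lambda>x y. \<iota> (\<kappa> x \<otimes>\<^bsub>K\<^esub> \<kappa> y)), one = \<iota> \<one>\<^bsub>K\<^esub>\<rparr>"
  have M: "carrier M = \<iota> ` ?C" "x \<otimes>\<^bsub>M\<^esub> y = \<iota> (\<kappa> x \<otimes>\<^bsub>K\<^esub> \<kappa> y)" "\<one>\<^bsub>M\<^esub> = \<iota> \<one>\<^bsub>K\<^esub>" for x y
    by (simp_all add: M_def)
  have iso: "\<iota> \<in> iso K M"
    using inj by (auto simp: iso_def hom_def bij_betw_def M \<kappa>\<iota>)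
  have "group (M\<lparr>one := \<iota> \<one>\<^bsub>K\<^esub>\<rparr>)" using K.iso_imp_img_group[OF iso] .
  then interpret M: group M by (simp add: M_def)
  have hom: "group_hom K M \<iota>"
    using iso by (simp add: group_hom_def group_hom_axioms_def K.is_group M.is_group iso_def)
  define s' where "s' = {(x, y). x \<in> carrier M \<and> y \<in> carrier M \<and> (\<kappa> x, \<kappa> y) \<in> s}"
  have s': "(\<iota> x, \<iota> y) \<in> s' \<longleftrightarrow> (x, y) \<in> s" if "x \<in> ?C" "y \<in> ?C" for x y
    using that by (simp add: s'_def M \<kappa>\<iota>)
  have \<kappa>C: "\<kappa> x \<in> ?C" "\<iota> (\<kappa> x) = x" if "x \<in> carrier M" for x
    using that by (auto simp: M \<kappa>\<iota>)
  have lin: "refl_on ?C s" "trans s" "antisym s" "total_on ?C s"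
    using K(1) by (simp_all add: left_ordered_group_def linear_order_on_def partial_order_on_def preorder_on_def)
  have "linear_order_on (carrier M) s'"
    unfolding linear_order_on_def partial_order_on_def preorder_on_def
  proof (intro conjI)
    show "refl_on (carrier M) s'" using lin(1) \<kappa>C by (auto simp: refl_on_def s'_def)
    show "trans s'" using lin(2) by (auto intro!: transI dest: transD simp: s'_def)
    show "antisym s'"
    proof (rule antisymI)
      fix x y assume "(x, y) \<in> s'" "(y, x) \<in> s'"
      then have "\<kappa> x = \<kappa> y" "x \<in> carrier M" "y \<in> carrier M" using antisymD[OF lin(3)] by (auto simp: s'_def)
      then show "x = y" using \<kappa>C(2) by metis
    qed
    show "total_on (carrier M) s'"
    proof (rule total_onI)
      fix x y assume xy: "x \<in> carrier M" "y \<in> carrier M" "x \<noteq> y"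
      then have "\<kappa> x \<noteq> \<kappa> y" using \<kappa>C(2) by metis
      then show "(x, y) \<in> s' \<or> (y, x) \<in> s'" using lin(4) xy \<kappa>C by (auto simp: total_on_def s'_def)
    qed
  qed (auto simp: s'_def)
  moreover have "(a \<otimes>\<^bsub>M\<^esub> x, a \<otimes>\<^bsub>M\<^esub> y) \<in> s'"
    if "a \<in> carrier M" "x \<in> carrier M" "y \<in> carrier M" "(x, y) \<in> s'" for a x y
  proof -
    have "(\<kappa> a \<otimes>\<^bsub>K\<^esub> \<kappa> x, \<kappa> a \<otimes>\<^bsub>K\<^esub> \<kappa> y) \<in> s"
      using K(1) that \<kappa>C(1) unfolding left_ordered_group_def s'_def by auto
    then show ?thesis using s' that \<kappa>C(1) by (simp add: M(2))
  qed
  ultimately have "left_ordered_group M s'" using M.is_group by (simp add: left_ordered_group_def)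
  moreover have "finitely_generated M"
  proof -
    obtain S where S: "finite S" "S \<subseteq> ?C" "generate K S = ?C" using K(2) by (auto simp: finitely_generated_def)
    then have "generate M (\<iota> ` S) = carrier M" using group_hom.generate_img[OF hom S(2)] by (simp add: M(1))
    then show ?thesis unfolding finitely_generated_def using S by (intro exI[of _ "\<iota> ` S"]) (auto simp: M(1))
  qed
  moreover have "is_simple M"
    unfolding is_simple_def
  proof (intro conjI allI impI)
    fix N assume N: "N \<lhd> M"
    have "\<kappa> \<in> iso M K" unfolding \<kappa>_def by (rule K.iso_set_sym[OF iso])
    then have "\<kappa> ` N \<lhd> K" using iso_normal_subgroup N M.is_group K.is_group by blast
    then have "\<kappa> ` N = ?C \<or> \<kappa> ` N = {\<one>\<^bsub>K\<^esub>}" using K(3) by (simp add: is_simple_def)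
    moreover have "\<iota> (\<kappa> x) = x" if "x \<in> N" for x
      using \<kappa>C(2) that subgroup.subset[OF normal_imp_subgroup[OF N]] by (simp add: subsetD)
    then have "N = \<iota> ` (\<kappa> ` N)" by (simp add: image_image)
    ultimately show "N = carrier M \<or> N = {\<one>\<^bsub>M\<^esub>}"
      by (elim disjE) (simp_all add: M(1,3))
  qed (rule M.is_group)
  moreover have "\<iota> \<in> mon K M" using iso by (simp add: iso_iff_mon_epi)
  then have "\<iota> \<circ> \<phi> \<in> mon G M" using \<phi>(1) by (rule mon_compose[rotated])
  moreover have "\<phi> x \<in> ?C" if "x \<in> carrier G" for x using \<phi>(1) that by (auto simp: mon_def hom_def)
  then have "\<forall>x\<in>carrier G. \<forall>y\<in>carrier G. (x, y) \<in> r \<longleftrightarrow> ((\<iota> \<circ> \<phi>) x, (\<iota> \<circ> \<phi>) y) \<in> s'"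
    using \<phi>(2) s' by simp
  ultimately show ?thesis by blast
qed

section \<open>The embedding\<close>

theorem theorem1:
  fixes G :: "('a, 'b) monoid_scheme" and r :: "'a rel"
  assumes "left_ordered_group G r"
    and "countable (carrier G)"
  shows "\<exists>(H :: nat monoid) s \<phi>.
           left_ordered_group H s \<and> finitely_generated H \<and> is_simple H \<and>
           \<phi> \<in> mon G H \<and>
           (\<forall>x\<in>carrier G. \<forall>y\<in>carrier G. (x, y) \<in> r \<longleftrightarrow> (\<phi> x, \<phi> y) \<in> s)"
proof -
  have G: "group G" using assms(1) by (simp add: left_ordered_group_def)
  then have ne: "carrier G \<noteq> {}" using group.is_monoid monoid.one_closed by blast
  obtain act x0 where act: "x0 \<in> J" "\<forall>g\<in>carrier G. autJ (act g)"
    "\<forall>g\<in>carrier G. \<forall>h\<in>carrier G. act (g \<otimes>\<^bsub>G\<^esub> h) = act g \<circ> act h"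
    "\<forall>g\<in>carrier G. \<forall>h\<in>carrier G. (g, h) \<in> r \<longleftrightarrow> act g x0 \<le> act h x0"
    by (rule left_ordered_action[OF assms])
  obtain h w where h: "h \<in> circle_group" "autJ w" "rot = h \<circ> spread UNIV w \<circ> inv_fun h \<circ> bumpZ"
    using rotation_spread .
  \<comment> \<open>Term 3 of the sequence \<open>p\<close> below forces the rotation into every nontrivial normal subgroup; the terms
    from 4 on enumerate \<open>G\<close>.\<close>
  define q where "q i = (case i of 0 \<Rightarrow> w | Suc j \<Rightarrow> act (from_nat_into (carrier G) j))" for i
  have "autJ (q i)" for i
    using h(2) act(2) from_nat_into[OF ne] by (simp add: q_def split: nat.split)
  from self_encoding[OF this] obtain p c where p: "c \<in> circle_group" "\<forall>x\<in>J. c x \<in> J" "\<forall>i. autJ (p i)"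
    "p 2 = bump" "\<forall>i. p (i + 3) = q i"
    "\<forall>i. \<exists>a\<in>gen {p 0, p 1, p 2}. c \<circ> p i \<circ> inv_fun c = a \<circ> p 1 \<circ> inv_fun a \<circ> inv_fun (p 1)"
    .
  interpret simple_construction p c h
  proof
    show "rot = h \<circ> spread UNIV (p 3) \<circ> inv_fun h \<circ> spread UNIV bump"
      using h(3) spec[OF p(5), of 0] by (simp add: q_def)
    show "\<exists>a\<in>gen {p 0, p 1, p 2}. c \<circ> p i \<circ> inv_fun c = a \<circ> p 1 \<circ> inv_fun a \<circ> inv_fun (p 1)" for i
      using p(6) by (rule spec)
  qed (simp_all add: p h bspec[OF p(2)] spec[OF p(3)])
  let ?K = "AutQ\<lparr>carrier := H\<rparr>"
  have sub: "subgroup H AutQ" using H_subgrp by (simp add: subgrp_iff_subgroup)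
  have grpK: "group ?K" by (rule group.subgroup_imp_group[OF AutQ_group sub])
  have SH: "S \<subseteq> H" unfolding H_def by (blast intro: gen_base)
  have "finitely_generated ?K"
    unfolding finitely_generated_def
  proof (intro exI conjI)
    show "finite S" by (simp add: S_def)
    show "generate ?K S = carrier ?K"
      using group.generate_consistent[OF AutQ_group SH sub] by (simp add: H_def)
  qed (simp add: SH)
  moreover have "is_simple ?K"
    unfolding is_simple_def
  proof (intro conjI allI impI)
    fix N assume N: "N \<lhd> ?K"
    have subN: "subgroup N ?K" using N by (rule normal_imp_subgroup)
    have "normalH N"
      unfolding normalH_def
    proof (intro conjI ballI)
      show "subgrp N" using group.incl_subgroup[OF AutQ_group sub subN] by (simp add: subgrp_iff_subgroup)
      show "N \<subseteq> H" using subgroup.subset[OF subN] by simp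
      fix f n assume fn: "f \<in> H" "n \<in> N"
      have "inv\<^bsub>?K\<^esub> f = inv_fun f"
        using group.m_inv_consistent[OF AutQ_group sub fn(1)] subgrpD(1)[OF H_subgrp fn(1)] by simp
      then show "f \<circ> n \<circ> inv_fun f \<in> N"
        using normal.inv_op_closed2[OF N, of f n] fn by simp
    qed
    then show "N = carrier ?K \<or> N = {\<one>\<^bsub>?K\<^esub>}" using H_simple[of N] by auto
  qed (rule grpK)
  moreover have "countable (carrier ?K)"
    using countable_gen[of S] S_aut by (simp add: H_def) (simp add: S_def)
  moreover define \<phi> where "\<phi> g = spread UNIV (act g)" for g
  have \<phi>H: "\<phi> g \<in> H" if g: "g \<in> carrier G" for g
  proof -
    obtain j where "g = from_nat_into (carrier G) j" using from_nat_into_surj[OF assms(2) g] by metis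
    then have "act g = p (Suc j + 3)" using spec[OF p(5), of "Suc j"] by (simp add: q_def)
    then show ?thesis using spreads_in_H_UNIV by (metis spreads_in_def \<phi>_def)
  qed
  have \<phi>x0: "\<phi> g x0 = act g x0" for g
  proof -
    have "\<lfloor>x0\<rfloor> = 0" using act(1) by (simp add: J_def floor_eq_iff)
    then show ?thesis by (simp add: \<phi>_def spread_def frac_def)
  qed
  have order: "(x, y) \<in> r \<longleftrightarrow> (\<phi> x, \<phi> y) \<in> aut_order x0 H" if xy: "x \<in> carrier G" "y \<in> carrier G" for x y
  proof (cases "act x x0 = act y x0")
    case True
    then have "(x, y) \<in> r" "(y, x) \<in> r" using bspec[OF bspec[OF act(4)]] xy by auto
    then have "x = y" using assms(1)
      by (auto simp: left_ordered_group_def linear_order_on_def partial_order_on_def dest: antisymD)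
    then show ?thesis using \<open>(x, y) \<in> r\<close> \<phi>H xy by (simp add: aut_order_def)
  next
    case False
    then show ?thesis
      using aut_order_at_base_point[OF \<phi>H[OF xy(1)] \<phi>H[OF xy(2)], of x0] bspec[OF bspec[OF act(4) xy(1)] xy(2)] \<phi>x0 by auto
  qed
  have "\<phi> \<in> mon G ?K"
    unfolding mon_def hom_def
  proof (intro CollectI conjI ballI inj_onI Pi_I)
    show "\<phi> x \<in> carrier ?K" if "x \<in> carrier G" for x using \<phi>H that by simp
    show "\<phi> (x \<otimes>\<^bsub>G\<^esub> y) = \<phi> x \<otimes>\<^bsub>?K\<^esub> \<phi> y" if "x \<in> carrier G" "y \<in> carrier G" for x y
      using that act(2,3) by (simp add: \<phi>_def spread_comp)
    show "x = y" if xy: "x \<in> carrier G" "y \<in> carrier G" "\<phi> x = \<phi> y" for x y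
    proof -
      have "(x, y) \<in> r" "(y, x) \<in> r" using order xy \<phi>H by (auto simp: aut_order_def)
      then show ?thesis using assms(1)
        by (auto simp: left_ordered_group_def linear_order_on_def partial_order_on_def dest: antisymD)
    qed
  qed
  ultimately show ?thesis
    using transport_to_nat[OF left_ordered_aut[OF H_subgrp, of x0]] order by blast
qed

end
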